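(* Let $q\ge1$, let $A=(a_1,\ldots,a_q)$, $B=(b_1,\ldots,b_q)$ be real vectors with $B\prec^W A$, let $0<\sigma\le1$, and let $j\ge-1$ be an integer. Then the Padé approximants $[m+j/m]$ (numerator degree $m+j$, denominator degree $m$) at $z=0$ to the function $z\mapsto{}_{q+1}F_q(\sigma,A;B;-z)$ converge to this function uniformly on every compact subset of $\mathbb{C}\setminus(-\infty,-1]$ as $m\to\infty$.
   Context: $B\prec^W A$ means: $0<a_1\le\cdots\le a_q$, $0<b_1\le\cdots\le b_q$, and $\sum_{i=1}^{k}a_i\le\sum_{i=1}^{k}b_i$ for $k=1,\ldots,q$. The generalized hypergeometric function is ${}_{q+1}F_q(\sigma,A;B;z)=\sum_{n=0}^{\infty}\frac{(\sigma)_n(a_1)_n\cdots(a_q)_n}{(b_1)_n\cdots(b_q)_n\,n!}z^n$ for $|z|<1$, extended by analytic continuation to $\mathbb{C}\setminus[1,\infty)$; $(a)_0=1$, $(a)_n=a(a+1)\cdots(a+n-1)$. The Padé approximant $[k/n]$ at $z=0$ to $f$ is the rational function $P/Q$ determined by polynomials $P$, $Q\not\equiv0$ with $\deg P\le k$, $\deg Q\le n$ and $f(z)Q(z)-P(z)=O(z^{k+n+1})$ as $z\to0$. *)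

theory Defs
  imports
    "HOL-Complex_Analysis.Complex_Analysis"
    "HOL-Computational_Algebra.Computational_Algebra"
    "HOL-Computational_Algebra.Field_as_Ring"
begin

definition weakly_supermajorized :: "real list \<Rightarrow> real list \<Rightarrow> bool"
    (infix \<open>\<prec>\<^sup>W\<close> 50) where
  "B \<prec>\<^sup>W A \<longleftrightarrow>
     length A = length B \<and>
     (\<forall>a\<in>set A. 0 < a) \<and> sorted A \<and>
     (\<forall>b\<in>set B. 0 < b) \<and> sorted B \<and>
     (\<forall>k\<in>{1..length A}. sum_list (take k A) \<le> sum_list (take k B))"

text \<open>
  The function is the holomorphic continuation of the hypergeometric series from the unit disc
  to the plane cut along \<open>[1,\<infinity>)\<close>. On the cut plane it is unique by the identity theorem;
  on the cut itself its values are unspecified.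
\<close>

definition hypergeo_fun :: "real \<Rightarrow> real list \<Rightarrow> real list \<Rightarrow> complex \<Rightarrow> complex" where
  "hypergeo_fun \<sigma> A B =
     (SOME F. F holomorphic_on (- complex_of_real ` {1..}) \<and>
        (\<forall>z. norm z < 1 \<longrightarrow>
           F z = eval_fps (fps_hypergeo (map complex_of_real (\<sigma> # A)) (map complex_of_real B) 1) z))"

text \<open>
  Rational functions are elements of the fraction field of the polynomial ring, so the
  approximant does not depend on the choice of the pair \<open>P\<close>, \<open>Q\<close>, which in general
  may have common factors.
\<close>

definition pade :: "(complex \<Rightarrow> complex) \<Rightarrow> nat \<Rightarrow> nat \<Rightarrow> complex poly fract" where
  "pade f k n =
     (THE r. \<exists>P Q. Q \<noteq> 0 \<and> degree P \<le> k \<and> degree Q \<le> n \<and>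
        (\<lambda>z. f z * poly Q z - poly P z) \<in> O[at 0](\<lambda>z. z ^ (k + n + 1)) \<and>
        r = Fraction_Field.Fract P Q)"

text \<open>
  Values and poles of a rational function are taken from its representation in lowest terms.
  At a pole the value is \<open>0\<close> by the convention for division by zero.
\<close>

definition ratfun_eval :: "complex poly fract \<Rightarrow> complex \<Rightarrow> complex" where
  "ratfun_eval r z = poly (fst (quot_of_fract r)) z / poly (snd (quot_of_fract r)) z"

definition ratfun_pole :: "complex poly fract \<Rightarrow> complex \<Rightarrow> bool" where
  "ratfun_pole r z \<longleftrightarrow> poly (snd (quot_of_fract r)) z = 0"

text \<open>
  Since division by zero is total, locally uniform convergence of rational functions has to
  include explicitly that the compact set is eventually free of poles.
\<close>

definition ratfun_converges_compactly ::
    "(nat \<Rightarrow> complex poly fract) \<Rightarrow> (complex \<Rightarrow> complex) \<Rightarrow> complex set \<Rightarrow> bool" where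
  "ratfun_converges_compactly R f S \<longleftrightarrow>
     (\<forall>K. compact K \<and> K \<subseteq> S \<longrightarrow>
        (\<forall>\<^sub>F m in sequentially. \<forall>z\<in>K. \<not> ratfun_pole (R m) z) \<and>
        uniform_limit K (\<lambda>m. ratfun_eval (R m)) f sequentially)"

end

theory Submission
  imports Defs "HOL-Real_Asymp.Real_Asymp"
begin

text \<open>
  The Taylor coefficients of the function (in \<open>- z\<close>) form a Hausdorff moment sequence, i.e. they define
  a functional \<open>L\<close> on polynomials that is nonnegative on polynomials nonnegative on \<open>[0,1]\<close>:
  \<open>\<Prod>\<^sub>i (1 - r powr (n + b\<^sub>i)) / (1 - r powr (n + a\<^sub>i))\<close> is the exponential of a combination of the
  sequences \<open>(r ^ j) ^ n\<close> whose coefficients are nonnegative by majorization; let \<open>r \<rightarrow> 1\<close> and multiply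
  over the shifts \<open>n, n + 1, \<dots>\<close> to reach the quotient of Pochhammer symbols.

  For such a functional, shifted by \<open>t ^ (j + 1)\<close>, the Gauss quadrature rule with \<open>m\<close> nodes in
  \<open>[0,1]\<close>, applied to \<open>1 / (1 + t z)\<close>, gives the approximant \<open>[m + j / m]\<close>. The rule is exact up to
  degree \<open>2 m - 1\<close> and has nonnegative weights of constant sum, so uniform polynomial approximation of
  \<open>1 / (1 + t z)\<close> shows that the approximants are uniformly Cauchy on compact sets. Their limit
  is itself the analytic continuation, and no representing measure is needed.
\<close>

subsection \<open>Moment sequences of the hypergeometric function\<close>

text \<open>The functional sending \<open>t ^ n\<close> to \<open>c n\<close>. Positivity is tested
  on real polynomials, while quadrature uses complex ones, which split into linear factors; hence
  the general field.\<close>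

definition moment :: "(nat \<Rightarrow> real) \<Rightarrow> 'a::real_normed_field poly \<Rightarrow> 'a" where
  "moment c p = (\<Sum>i\<le>degree p. c i *\<^sub>R coeff p i)"

lemma moment_eq_sum:
  assumes "degree p \<le> N"
  shows "moment c p = (\<Sum>i\<le>N. c i *\<^sub>R coeff p i)"
  unfolding moment_def
  by (rule sum.mono_neutral_left) (use assms in \<open>auto simp: coeff_eq_0\<close>)

lemma moment_0 [simp]: "moment c 0 = 0"
  by (simp add: moment_def)

lemma moment_add: "moment c (p + q) = moment c p + moment c q"
proof -
  let ?N = "max (degree p) (degree q)"
  have "degree (p + q) \<le> ?N" by (simp add: degree_add_le_max)
  then show ?thesis
    by (simp add: moment_eq_sum[of _ ?N] scaleR_add_right sum.distrib)
qed

lemma moment_smult: "moment c (smult a p) = a * moment c p"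
  by (simp add: moment_eq_sum[OF degree_smult_le] moment_eq_sum[of p "degree p"] sum_distrib_left)

lemma moment_minus: "moment c (- p) = - moment c p"
  using moment_smult[of c "-1" p] by simp

lemma moment_diff: "moment c (p - q) = moment c p - moment c q"
  using moment_add[of c p "- q"] by (simp add: moment_minus)

lemma moment_sum: "moment c (\<Sum>i\<in>I. p i) = (\<Sum>i\<in>I. moment c (p i))"
  by (induction I rule: infinite_finite_induct) (auto simp: moment_add)

lemma moment_monom: "moment c (monom a n) = c n *\<^sub>R a"
proof -
  have "moment c (monom a n) = (\<Sum>i\<le>n. c i *\<^sub>R coeff (monom a n) i)"
    by (rule moment_eq_sum) (rule degree_monom_le)
  also have "\<dots> = (\<Sum>i\<in>{n}. c i *\<^sub>R coeff (monom a n) i)"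
    by (rule sum.mono_neutral_right) auto
  finally show ?thesis by simp
qed

lemma moment_monom_mult: "moment c (monom 1 d * p) = moment (\<lambda>n. c (n + d)) p"
proof -
  have "p = (\<Sum>i\<le>degree p. monom (coeff p i) i)"
    by (simp add: poly_as_sum_of_monoms)
  then have "moment c (monom 1 d * p) = moment c (\<Sum>i\<le>degree p. monom 1 d * monom (coeff p i) i)"
    by (metis sum_distrib_left)
  also have "\<dots> = (\<Sum>i\<le>degree p. c (i + d) *\<^sub>R coeff p i)"
    by (simp add: moment_sum mult_monom moment_monom add.commute)
  finally show ?thesis by (simp add: moment_def)
qed

text \<open>Positivity in this form is equivalent to being the moments of a positive measure on
  \<open>[0,1]\<close>. It survives pointwise limits because each \<open>moment c p\<close> has
  finitely many terms.\<close>

definition hausdorff :: "(nat \<Rightarrow> real) \<Rightarrow> bool" where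
  "hausdorff c \<longleftrightarrow> (\<forall>p::real poly. (\<forall>x\<in>{0..1}. 0 \<le> poly p x) \<longrightarrow> 0 \<le> moment c p)"

section \<open>Closure properties of Hausdorff moment sequences\<close>

lemma hausdorff_power: "x \<in> {0..1} \<Longrightarrow> hausdorff (\<lambda>n. x ^ n)"
  by (auto simp: hausdorff_def moment_def poly_altdef mult.commute)

lemma hausdorff_cmult: "0 \<le> a \<Longrightarrow> hausdorff c \<Longrightarrow> hausdorff (\<lambda>n. a * c n)"
  by (auto simp: hausdorff_def moment_def mult.assoc simp flip: sum_distrib_left)

lemma hausdorff_sum:
  assumes "\<And>i. i \<in> I \<Longrightarrow> hausdorff (c i)"
  shows "hausdorff (\<lambda>n. \<Sum>i\<in>I. c i n)"
proof -
  have "moment (\<lambda>n. \<Sum>i\<in>I. c i n) p = (\<Sum>i\<in>I. moment (c i) p)" for p :: "real poly"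
    unfolding moment_def by (subst sum.swap) (simp add: sum_distrib_right)
  then show ?thesis
    using assms by (auto simp: hausdorff_def intro!: sum_nonneg)
qed

lemma hausdorff_tendsto:
  assumes "\<And>k. hausdorff (c k)" and "\<And>n. (\<lambda>k. c k n) \<longlonglongrightarrow> d n"
  shows "hausdorff d"
  unfolding hausdorff_def
proof (intro allI impI)
  fix p :: "real poly"
  assume p: "\<forall>x\<in>{0..1}. 0 \<le> poly p x"
  have "(\<lambda>k. moment (c k) p) \<longlonglongrightarrow> moment d p"
    unfolding moment_def by (intro tendsto_intros assms)
  then show "0 \<le> moment d p"
    by (rule LIMSEQ_le_const) (use p assms(1) in \<open>auto simp: hausdorff_def\<close>)
qed

text \<open>Multiplicative convolution of measures: for fixed \<open>x\<close> in
  \<open>[0,1]\<close>, applying \<open>c\<close> to \<open>y \<mapsto> p (y x)\<close> gives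
  \<open>poly r x \<ge> 0\<close>, and applying \<open>d\<close> to \<open>r\<close> gives the
  moment of \<open>p\<close> for the product sequence.\<close>

lemma hausdorff_mult:
  assumes "hausdorff c" and "hausdorff d"
  shows "hausdorff (\<lambda>n. c n * d n)"
  unfolding hausdorff_def
proof (intro allI impI)
  fix p :: "real poly"
  assume p: "\<forall>x\<in>{0..1}. 0 \<le> poly p x"
  define r where "r = (\<Sum>i\<le>degree p. monom (coeff p i * c i) i)"
  have coeff_r: "coeff r i = coeff p i * c i" for i
    by (cases "i \<le> degree p") (auto simp: r_def coeff_sum coeff_monom sum.delta coeff_eq_0)
  have deg_r: "degree r \<le> degree p"
    by (rule degree_le) (simp add: coeff_r coeff_eq_0)
  have "0 \<le> poly r x" if x: "x \<in> {0..1}" for x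
  proof -
    let ?p = "p \<circ>\<^sub>p [:0, x:]"
    have "poly ?p y \<ge> 0" if "y \<in> {0..1}" for y
    proof -
      have "y * x \<in> {0..1}" using x that by (auto intro: mult_le_one)
      then show ?thesis using p by (simp add: poly_pcompose)
    qed
    then have "0 \<le> moment c ?p" using assms(1) by (simp add: hausdorff_def)
    also have "moment c ?p = (\<Sum>i\<le>degree p. c i * coeff ?p i)"
      by (subst moment_eq_sum[of _ "degree p"]) (use degree_pcompose_le[of p "[:0, x:]"] in \<open>auto split: if_splits\<close>)
    also have "\<dots> = (\<Sum>i\<le>degree p. coeff r i * x ^ i)"
      by (simp add: coeff_pcompose_linear coeff_r mult_ac)
    also have "\<dots> = poly r x"
      unfolding poly_altdef
      by (rule sum.mono_neutral_right) (use deg_r in \<open>auto simp: coeff_eq_0\<close>)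
    finally show ?thesis .
  qed
  then have "0 \<le> moment d r" using assms(2) by (simp add: hausdorff_def)
  also have "moment d r = moment (\<lambda>n. c n * d n) p"
    using deg_r by (simp add: moment_eq_sum[of _ "degree p"] coeff_r mult_ac)
  finally show "0 \<le> moment (\<lambda>n. c n * d n) p" .
qed

lemma hausdorff_const: "0 \<le> a \<Longrightarrow> hausdorff (\<lambda>n. a)"
  using hausdorff_cmult[OF _ hausdorff_power[of 1], of a] by simp

lemma hausdorff_prod:
  assumes "\<And>i. i \<in> I \<Longrightarrow> hausdorff (c i)"
  shows "hausdorff (\<lambda>n. \<Prod>i\<in>I. c i n)"
  using assms
  by (induction I rule: infinite_finite_induct) (auto intro: hausdorff_mult hausdorff_const)

text \<open>\<open>exp (c n)\<close> is the limit of \<open>(1 + c n / k) ^ k\<close>, which is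
  built by sums and products. At \<open>k = 0\<close> the coefficient \<open>1 / real k\<close> is
  \<open>0\<close>, hence still nonnegative.\<close>

lemma hausdorff_exp:
  assumes "hausdorff c"
  shows "hausdorff (\<lambda>n. exp (c n))"
proof (rule hausdorff_tendsto)
  fix k :: nat
  have "hausdorff (\<lambda>n. \<Sum>i\<in>{0,1::nat}. if i = 0 then 1 else (1 / real k) * c n)"
    by (rule hausdorff_sum) (auto intro!: hausdorff_const hausdorff_cmult assms simp del: times_divide_eq_left)
  then have "hausdorff (\<lambda>n. 1 + c n / real k)" by simp
  then have "hausdorff (\<lambda>n. \<Prod>i<k. 1 + c n / real k)" by (rule hausdorff_prod)
  then show "hausdorff (\<lambda>n. (1 + c n / real k) ^ k)" by simp
qed (rule tendsto_exp_limit_sequentially)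

lemma hausdorff_shift:
  assumes "hausdorff c"
  shows "hausdorff (\<lambda>n. c (n + d))"
  unfolding hausdorff_def
proof (intro allI impI)
  fix p :: "real poly"
  assume p: "\<forall>x\<in>{0..1}. 0 \<le> poly p x"
  then have "\<forall>x\<in>{0..1}. 0 \<le> poly (monom 1 d * p) x" by (simp add: poly_monom)
  then show "0 \<le> moment (\<lambda>n. c (n + d)) p"
    using assms by (simp add: hausdorff_def flip: moment_monom_mult)
qed

section \<open>From majorization to quotients of Pochhammer symbols\<close>

lemma abel_sum_nonneg:
  fixes d g :: "nat \<Rightarrow> real"
  assumes "\<And>k. k \<le> q \<Longrightarrow> 0 \<le> (\<Sum>i<k. d i)"
    and "\<And>i. 0 \<le> g i" and "\<And>i. Suc i < q \<Longrightarrow> g (Suc i) \<le> g i"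
  shows "0 \<le> (\<Sum>i<q. d i * g i)"
proof (cases q)
  case (Suc q')
  \<comment> \<open>Inductive form of Abel summation: since the partial sums of \<open>d\<close> are
    nonnegative, replacing all weights by the last and smallest one \<open>g k\<close> can only
    lower the sum.\<close>
  have "(\<Sum>i<Suc k. d i) * g k \<le> (\<Sum>i<Suc k. d i * g i)" if "k < q" for k
    using that
  proof (induction k)
    case (Suc k)
    have "(\<Sum>i<Suc k. d i) * g (Suc k) \<le> (\<Sum>i<Suc k. d i) * g k"
      using Suc.prems assms(1)[of "Suc k"] assms(3) by (intro mult_left_mono) auto
    also have "\<dots> \<le> (\<Sum>i<Suc k. d i * g i)"
      using Suc by simp
    finally show ?case by (simp add: distrib_right)
  qed simp
  from this[of q'] show ?thesis
    using mult_nonneg_nonneg[OF assms(1)[of q] assms(2)[of q']] Suc by auto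
qed simp

text \<open>Bound the convex function \<open>u \<mapsto> \<rho> powr u\<close> from below by its tangents at the points
  \<open>b i\<close>; their slopes increase in \<open>i\<close>, so Abel summation applies.\<close>

lemma majorization_powr:
  fixes a b :: "nat \<Rightarrow> real"
  assumes maj: "\<And>k. k \<le> q \<Longrightarrow> (\<Sum>i<k. a i) \<le> (\<Sum>i<k. b i)"
    and mono: "\<And>i. Suc i < q \<Longrightarrow> b i \<le> b (Suc i)"
    and \<rho>: "0 < \<rho>" "\<rho> < 1"
  shows "(\<Sum>i<q. \<rho> powr b i) \<le> (\<Sum>i<q. \<rho> powr a i)"
proof -
  have "0 \<le> (\<Sum>i<q. (b i - a i) * \<rho> powr b i)"
  proof (rule abel_sum_nonneg)
    show "\<rho> powr b (Suc i) \<le> \<rho> powr b i" if "Suc i < q" for i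
      using \<rho> mono[OF that] by (simp add: powr_mono')
  qed (use maj in \<open>auto simp: sum_subtractf\<close>)
  then have "0 \<le> (- ln \<rho>) * (\<Sum>i<q. (b i - a i) * \<rho> powr b i)"
    using \<rho> by (intro mult_nonneg_nonneg) auto
  also have "\<dots> = (\<Sum>i<q. (- ln \<rho>) * ((b i - a i) * \<rho> powr b i))"
    by (rule sum_distrib_left)
  also have "\<dots> \<le> (\<Sum>i<q. \<rho> powr a i - \<rho> powr b i)"
  proof (rule sum_mono)
    fix i
    have "1 + (a i - b i) * ln \<rho> \<le> exp ((a i - b i) * ln \<rho>)"
      by (rule exp_ge_add_one_self)
    then have "(1 + (a i - b i) * ln \<rho>) * \<rho> powr b i \<le> exp ((a i - b i) * ln \<rho>) * \<rho> powr b i"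
      by (intro mult_right_mono) auto
    also have "\<dots> = \<rho> powr a i"
      using \<rho> by (simp add: powr_def algebra_simps flip: exp_add)
    finally show "(- ln \<rho>) * ((b i - a i) * \<rho> powr b i) \<le> \<rho> powr a i - \<rho> powr b i"
      by (simp add: algebra_simps)
  qed
  finally show ?thesis by (simp add: sum_subtractf)
qed

lemma ln_one_minus_sums:
  fixes y :: real
  assumes "0 < y" "y < 1"
  shows "(\<lambda>j. y ^ j / real j) sums (- ln (1 - y))"
  using sums_minus[OF ln_series'[of "- y"]] assms by simp

text \<open>The series of \<open>- ln (1 - y)\<close> at \<open>y = r powr (n + x)\<close> turns the
  logarithm of the product into the sum of \<open>w j * (r ^ j) ^ n\<close>. The base
  \<open>r\<close> thus replaces the integral representation of
  \<open>ln ((n + b) / (n + a))\<close> by a series with Hausdorff partial sums.\<close>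

lemma hausdorff_q_quotient:
  fixes a b :: "nat \<Rightarrow> real"
  assumes maj: "\<And>k. k \<le> q \<Longrightarrow> (\<Sum>i<k. a i) \<le> (\<Sum>i<k. b i)"
    and mono: "\<And>i. Suc i < q \<Longrightarrow> b i \<le> b (Suc i)"
    and pos: "\<And>i. i < q \<Longrightarrow> 0 < a i" "\<And>i. i < q \<Longrightarrow> 0 < b i"
    and r: "0 < r" "r < 1"
  shows "hausdorff (\<lambda>n. \<Prod>i<q. (1 - r powr (real n + b i)) / (1 - r powr (real n + a i)))"
proof -
  \<comment> \<open>Nonnegative by majorization with base \<open>r ^ j\<close>. Division by
    \<open>real 0\<close> gives \<open>w 0 = 0\<close>, in agreement with the zero term at index
    \<open>0\<close> of the logarithmic series.\<close>
  define w where "w j = ((\<Sum>i<q. (r ^ j) powr a i) - (\<Sum>i<q. (r ^ j) powr b i)) / real j" for j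
  have w: "0 \<le> w j" for j
    using majorization_powr[of q a b "r ^ j"] maj mono r
    by (cases "j = 0") (auto simp: w_def power_Suc_less_one power_less_one_iff)
  define s where "s n = (\<Sum>i<q. ln ((1 - r powr (real n + b i)) / (1 - r powr (real n + a i))))" for n
  have less_1: "r powr (real n + x) < 1" if "0 < x" for n x
    using powr_less_mono'[of r 0 "real n + x"] that r by simp
  have neq_1: "r powr (real n + x) \<noteq> 1" if "0 < x" for n x
    using less_1[OF that] by (metis less_irrefl)
  have sums: "(\<lambda>j. w j * (r ^ j) ^ n) sums s n" for n
  proof -
    have "(\<lambda>j. \<Sum>i<q. (r powr (real n + a i)) ^ j / real j - (r powr (real n + b i)) ^ j / real j)
        sums (\<Sum>i<q. - ln (1 - r powr (real n + a i)) - - ln (1 - r powr (real n + b i)))"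
      using less_1 pos r by (intro sums_sum sums_diff ln_one_minus_sums) auto
    also have "(\<Sum>i<q. - ln (1 - r powr (real n + a i)) - - ln (1 - r powr (real n + b i))) = s n"
      unfolding s_def using neq_1 pos by (intro sum.cong) (auto simp: ln_div)
    also have "(\<lambda>j. \<Sum>i<q. (r powr (real n + a i)) ^ j / real j - (r powr (real n + b i)) ^ j / real j)
        = (\<lambda>j. w j * (r ^ j) ^ n)"
    proof
      fix j
      have "(r powr (real n + x)) ^ j = (r ^ j) ^ n * (r ^ j) powr x" for x
        using r by (simp add: powr_add powr_realpow power_mult_distrib powr_powr mult.commute
            flip: powr_realpow power_mult)
      then show "(\<Sum>i<q. (r powr (real n + a i)) ^ j / real j - (r powr (real n + b i)) ^ j / real j)
          = w j * (r ^ j) ^ n"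
        by (simp add: w_def sum_subtractf diff_divide_distrib right_diff_distrib mult.commute
            flip: sum_divide_distrib sum_distrib_left)
    qed
    finally show ?thesis .
  qed
  have "hausdorff (\<lambda>n. \<Sum>j<k. w j * (r ^ j) ^ n)" for k
    using r w by (intro hausdorff_sum hausdorff_cmult hausdorff_power) (auto simp: power_le_one)
  then have "hausdorff s"
    by (rule hausdorff_tendsto) (use sums in \<open>auto simp: sums_def\<close>)
  then have "hausdorff (\<lambda>n. exp (s n))" by (rule hausdorff_exp)
  also have "(\<lambda>n. exp (s n)) = (\<lambda>n. \<Prod>i<q. (1 - r powr (real n + b i)) / (1 - r powr (real n + a i)))"
    using less_1 pos by (auto simp: s_def exp_sum)
  finally show ?thesis .
qed

lemma hausdorff_linear_quotient:
  fixes a b :: "nat \<Rightarrow> real"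
  assumes maj: "\<And>k. k \<le> q \<Longrightarrow> (\<Sum>i<k. a i) \<le> (\<Sum>i<k. b i)"
    and mono: "\<And>i. Suc i < q \<Longrightarrow> b i \<le> b (Suc i)"
    and pos: "\<And>i. i < q \<Longrightarrow> 0 < a i" "\<And>i. i < q \<Longrightarrow> 0 < b i"
  shows "hausdorff (\<lambda>n. \<Prod>i<q. (real n + b i) / (real n + a i))"
proof (rule hausdorff_tendsto)
  \<comment> \<open>A sequence in \<open>(0,1)\<close> tending to \<open>1\<close>; in exponential
    form, \<open>powr\<close> becomes \<open>exp (- x / Suc k)\<close>, and each quotient
    \<open>(1 - r powr y) / (1 - r powr x)\<close> tends to \<open>y / x\<close>.\<close>
  let ?r = "\<lambda>k. exp (- 1 / real (Suc k))"
  show "hausdorff (\<lambda>n. \<Prod>i<q. (1 - ?r k powr (real n + b i)) / (1 - ?r k powr (real n + a i)))" for k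
    using assms by (intro hausdorff_q_quotient) auto
  have lim: "(\<lambda>k. (1 - ?r k powr y) / (1 - ?r k powr x)) \<longlonglongrightarrow> y / x" if "0 < x" "0 < y" for x y
    using that by (simp add: powr_def divide_inverse) real_asymp
  show "(\<lambda>k. \<Prod>i<q. (1 - ?r k powr (real n + b i)) / (1 - ?r k powr (real n + a i)))
      \<longlonglongrightarrow> (\<Prod>i<q. (real n + b i) / (real n + a i))" for n
    by (intro tendsto_prod lim) (use pos in \<open>auto intro: add_nonneg_pos\<close>)
qed

text \<open>Both cross products equal \<open>pochhammer x (n + N)\<close>. A product of
  \<open>N\<close> factors thereby becomes one of \<open>n\<close> factors, whose length stays fixed
  as \<open>N\<close> grows.\<close>

lemma prod_shift_pochhammer:
  fixes x :: real
  assumes "0 < x"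
  shows "(\<Prod>l<N. (real (n + l) + x) / (real l + x)) = pochhammer (x + real N) n / pochhammer x n"
proof -
  have "(\<Prod>l<N. (real (n + l) + x) / (real l + x)) = pochhammer (x + real n) N / pochhammer x N"
    by (simp add: pochhammer_prod prod_dividef lessThan_atLeast0 add_ac)
  also have "\<dots> = pochhammer (x + real N) n / pochhammer x n"
  proof (subst frac_eq_eq)
    show "pochhammer x N \<noteq> 0" "pochhammer x n \<noteq> 0"
      using pochhammer_pos[OF assms] by (metis less_irrefl)+
    show "pochhammer (x + real n) N * pochhammer x n = pochhammer (x + real N) n * pochhammer x N"
      using pochhammer_product'[of x n N] pochhammer_product'[of x N n]
      by (metis add.commute mult.commute)
  qed
  finally show ?thesis .
qed

text \<open>With \<open>R n\<close> the product of the \<open>(n + b i) / (n + a i)\<close>, the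
  target is \<open>1 / (R 0 * ... * R (n - 1))\<close>. As \<open>R\<close> tends to
  \<open>1\<close>, this is the telescoping infinite product of \<open>R (n + l) / R l\<close> over
  \<open>l\<close>, whose factors are shifts of \<open>R\<close> scaled by nonnegative
  constants.\<close>

lemma hausdorff_pochhammer_quotient:
  fixes a b :: "nat \<Rightarrow> real"
  assumes maj: "\<And>k. k \<le> q \<Longrightarrow> (\<Sum>i<k. a i) \<le> (\<Sum>i<k. b i)"
    and mono: "\<And>i. Suc i < q \<Longrightarrow> b i \<le> b (Suc i)"
    and pos: "\<And>i. i < q \<Longrightarrow> 0 < a i" "\<And>i. i < q \<Longrightarrow> 0 < b i"
  shows "hausdorff (\<lambda>n. \<Prod>i<q. pochhammer (a i) n / pochhammer (b i) n)"
proof (rule hausdorff_tendsto)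
  define R where "R n = (\<Prod>i<q. (real n + b i) / (real n + a i))" for n
  have R: "hausdorff R"
    unfolding R_def using assms by (rule hausdorff_linear_quotient)
  have R_nonneg: "0 \<le> R l" for l
    unfolding R_def using pos by (auto intro!: prod_nonneg divide_nonneg_nonneg simp: less_imp_le)
  show "hausdorff (\<lambda>n. \<Prod>l<N. (1 / R l) * R (n + l))" for N
    using R_nonneg by (intro hausdorff_prod hausdorff_cmult hausdorff_shift R) auto
  fix n
  have eq: "(\<Prod>l<N. (1 / R l) * R (n + l)) = (\<Prod>i<q. (pochhammer (b i + real N) n / pochhammer (b i) n) /
      (pochhammer (a i + real N) n / pochhammer (a i) n))" (is "_ = ?rhs") for N
  proof -
    have "(\<Prod>l<N. (1 / R l) * R (n + l))
       = (\<Prod>l<N. \<Prod>i<q. ((real (n + l) + b i) / (real l + b i)) / ((real (n + l) + a i) / (real l + a i)))"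
      by (simp add: R_def add_ac mult_ac flip: prod_dividef prod.distrib)
    also have "\<dots> = (\<Prod>i<q. \<Prod>l<N. ((real (n + l) + b i) / (real l + b i)) / ((real (n + l) + a i) / (real l + a i)))"
      by (rule prod.swap)
    also have "\<dots> = ?rhs"
      by (intro prod.cong refl, subst prod_dividef) (simp only: lessThan_iff prod_shift_pochhammer pos)
    finally show ?thesis .
  qed
  have lim1: "(\<lambda>N. pochhammer (y + real N) n / pochhammer (x + real N) n) \<longlonglongrightarrow> 1"
    if "0 < x" "0 < y" for x y
  proof -
    have "(\<lambda>N. \<Prod>s<n. (y + real N + real s) / (x + real N + real s)) \<longlonglongrightarrow> (\<Prod>s<n. 1)"
      by (intro tendsto_prod) (real_asymp)
    then show ?thesis
      by (simp add: pochhammer_prod prod_dividef lessThan_atLeast0)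
  qed
  have "(\<lambda>N. \<Prod>i<q. (pochhammer (b i + real N) n / pochhammer (a i + real N) n) *
      (pochhammer (a i) n / pochhammer (b i) n)) \<longlonglongrightarrow> (\<Prod>i<q. 1 * (pochhammer (a i) n / pochhammer (b i) n))"
    using pos by (intro tendsto_intros lim1) auto
  then show "(\<lambda>N. \<Prod>l<N. (1 / R l) * R (n + l)) \<longlonglongrightarrow> (\<Prod>i<q. pochhammer (a i) n / pochhammer (b i) n)"
    unfolding eq by (simp add: field_simps)
qed

subsection \<open>Gauss quadrature\<close>

text \<open>Gaussian elimination: equation \<open>i\<close> with pivot \<open>a i l\<close> removes
  the unknown \<open>l\<close> and leaves the coefficients \<open>b\<close> for the other equations;
  \<open>y\<close> then restores the value at \<open>l\<close> from equation
  \<open>i\<close>.\<close>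

lemma exists_homogeneous_solution:
  fixes a :: "'i \<Rightarrow> 'k \<Rightarrow> 'a::field"
  assumes "finite I" and "finite J" and "card I < card J"
  shows "\<exists>x. (\<exists>k\<in>J. x k \<noteq> 0) \<and> (\<forall>i\<in>I. (\<Sum>k\<in>J. a i k * x k) = 0)"
  using assms
proof (induction I arbitrary: J a rule: finite_induct)
  case empty
  then obtain k where "k \<in> J" by (metis card.empty equals0I less_irrefl)
  then show ?case by (intro exI[of _ "\<lambda>_. 1"]) auto
next
  case (insert i I)
  show ?case
  proof (cases "\<forall>k\<in>J. a i k = 0")
    case True
    obtain x where x: "\<exists>k\<in>J. x k \<noteq> 0" "\<forall>i\<in>I. (\<Sum>k\<in>J. a i k * x k) = 0"
      using insert.IH[of J a] insert.prems insert.hyps by (auto simp: Suc_lessD)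
    then show ?thesis using True by (intro exI[of _ x]) simp
  next
    case False
    then obtain l where l: "l \<in> J" "a i l \<noteq> 0" by auto
    define b where "b i' k = a i' k - a i' l * a i k / a i l" for i' k
    have "card I < card (J - {l})" using insert.prems insert.hyps l by simp
    then obtain x where x: "\<exists>k\<in>J - {l}. x k \<noteq> 0" "\<forall>i'\<in>I. (\<Sum>k\<in>J - {l}. b i' k * x k) = 0"
      using insert.IH[of "J - {l}" b] insert.prems by auto
    define s where "s = (\<Sum>k\<in>J - {l}. a i k * x k)"
    define y where "y = x(l := - s / a i l)"
    have sum_y: "(\<Sum>k\<in>J. a i' k * y k) = (\<Sum>k\<in>J - {l}. a i' k * x k) - a i' l * s / a i l" for i'
    proof -
      have "(\<Sum>k\<in>J. a i' k * y k) = a i' l * y l + (\<Sum>k\<in>J - {l}. a i' k * y k)"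
        using l insert.prems by (simp add: sum.remove)
      also have "(\<Sum>k\<in>J - {l}. a i' k * y k) = (\<Sum>k\<in>J - {l}. a i' k * x k)"
        by (intro sum.cong) (auto simp: y_def)
      finally show ?thesis by (simp add: y_def)
    qed
    have "(\<Sum>k\<in>J. a i' k * y k) = 0" if "i' \<in> I" for i'
    proof -
      have "0 = (\<Sum>k\<in>J - {l}. a i' k * x k - (a i' l / a i l) * (a i k * x k))"
        using x that by (simp add: b_def algebra_simps)
      also have "\<dots> = (\<Sum>k\<in>J. a i' k * y k)"
        by (simp add: sum_y s_def sum_subtractf flip: sum_distrib_left sum_divide_distrib)
      finally show ?thesis by simp
    qed
    moreover have "(\<Sum>k\<in>J. a i k * y k) = 0"
      using l by (simp add: sum_y s_def)
    moreover have "\<exists>k\<in>J. y k \<noteq> 0" using x(1) by (auto simp: y_def)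
    ultimately show ?thesis by blast
  qed
qed

section \<open>Positivity of the functional on complex polynomials\<close>

lemma poly_map_poly_Re: "poly (map_poly Re p) x = Re (poly p (of_real x))"
proof -
  have "degree (map_poly Re p) \<le> degree p" by (rule map_poly_degree_leq)
  then have "poly (map_poly Re p) x = (\<Sum>i\<le>degree p. Re (coeff p i) * x ^ i)"
    unfolding poly_altdef
    by (subst sum.mono_neutral_left[of "{..degree p}" "{..degree (map_poly Re p)}"])
      (auto simp: coeff_map_poly coeff_eq_0)
  then show ?thesis
    by (simp add: poly_altdef flip: of_real_power)
qed

lemma moment_map_poly_Re: "moment c (map_poly Re p) = Re (moment c p)"
proof -
  have "degree (map_poly Re p) \<le> degree p" by (rule map_poly_degree_leq)
  then show ?thesis
    by (simp add: moment_eq_sum[of _ "degree p"] coeff_map_poly)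
qed

lemma hausdorff_moment_nonneg:
  assumes "hausdorff c" and "\<And>x. x \<in> {0..1} \<Longrightarrow> poly p (complex_of_real x) \<in> \<real>\<^sub>\<ge>\<^sub>0"
  shows "moment c p \<in> \<real>\<^sub>\<ge>\<^sub>0"
proof -
  have nonneg: "0 \<le> Re (moment c p)" if "\<And>x. x \<in> {0..1} \<Longrightarrow> 0 \<le> Re (poly p (complex_of_real x))" for p
    using assms(1) that
    by (auto simp: hausdorff_def poly_map_poly_Re simp flip: moment_map_poly_Re)
  have "0 \<le> Re (moment c p)"
    by (rule nonneg) (use assms(2) in \<open>auto simp: complex_nonneg_Reals_iff\<close>)
  \<comment> \<open>The values of \<open>p\<close> on \<open>[0,1]\<close> are real, so both
    multiples have real part \<open>0\<close> there; the two inequalities force the imaginary part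
    of \<open>moment c p\<close> to vanish.\<close>
  moreover have "0 \<le> Re (moment c (smult \<i> p))" "0 \<le> Re (moment c (smult (- \<i>) p))"
    by (rule nonneg; use assms(2) in \<open>auto simp: complex_nonneg_Reals_iff\<close>)+
  then have "Im (moment c p) = 0"
    by (simp add: moment_smult moment_minus)
  ultimately show ?thesis by (simp add: complex_nonneg_Reals_iff)
qed

text \<open>Conjugating coefficients agrees with conjugating values at real points and stays within
  polynomials. For \<open>hausdorff c\<close>, this makes \<open>moment c (p * cnj_poly q)\<close> a
  positive semidefinite Hermitian form.\<close>

abbreviation cnj_poly :: "complex poly \<Rightarrow> complex poly" where
  "cnj_poly \<equiv> map_poly cnj"

lemma cnj_poly_add: "cnj_poly (p + q) = cnj_poly p + cnj_poly q"
  by (simp add: poly_eq_iff coeff_map_poly)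

lemma cnj_poly_smult: "cnj_poly (smult a p) = smult (cnj a) (cnj_poly p)"
  by (simp add: poly_eq_iff coeff_map_poly)

lemma cnj_poly_mult: "cnj_poly (p * q) = cnj_poly p * cnj_poly q"
  by (simp add: poly_eq_iff coeff_map_poly coeff_mult)

lemma cnj_poly_cnj_poly [simp]: "cnj_poly (cnj_poly p) = p"
  by (simp add: poly_eq_iff coeff_map_poly)

lemma degree_cnj_poly [simp]: "degree (cnj_poly p) = degree p"
  by (rule degree_map_poly) simp

lemma poly_mult_cnj_poly: "poly (p * cnj_poly p) (complex_of_real x) = of_real ((cmod (poly p x))\<^sup>2)"
proof -
  have "poly (cnj_poly p) (complex_of_real x) = cnj (poly p x)"
    by (simp add: poly_altdef coeff_map_poly)
  then show ?thesis by (simp add: complex_norm_square del: of_real_power)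
qed

lemma moment_cnj_poly: "moment c (cnj_poly p) = cnj (moment c p)"
  by (simp add: moment_def coeff_map_poly)

lemma moment_mult_cnj_nonneg:
  assumes "hausdorff c"
  shows "moment c (p * cnj_poly p) \<in> \<real>\<^sub>\<ge>\<^sub>0"
  using assms
  by (rule hausdorff_moment_nonneg) (simp only: poly_mult_cnj_poly nonneg_Reals_of_real_iff zero_le_power2)

text \<open>Degenerate case of the Cauchy-Schwarz inequality: a null vector of a semidefinite form
  is orthogonal to everything.\<close>

lemma moment_cauchy_schwarz_null:
  assumes "hausdorff c" and "moment c (s * cnj_poly s) = 0"
  shows "moment c (s * g) = 0"
proof -
  define u where "u = moment c (s * g)"
  define A where "A = Re (moment c (g * cnj_poly g))"
  have le: "2 * k * (cmod u)\<^sup>2 \<le> A" for k :: real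
  proof -
    \<comment> \<open>As \<open>s\<close> is null, the form at \<open>cnj_poly g + \<tau> s\<close>
      has no quadratic term in \<open>\<tau>\<close>. For this \<open>\<tau>\<close> its value is
      \<open>A - 2 k |u|^2\<close>, which can stay nonnegative for every \<open>k\<close> only if
      \<open>u = 0\<close>.\<close>
    define \<tau> where "\<tau> = - of_real k * cnj u"
    let ?p = "cnj_poly g + smult \<tau> s"
    have "?p * cnj_poly ?p = g * cnj_poly g + smult \<tau> (s * g) + smult (cnj \<tau>) (cnj_poly (s * g))
        + smult (\<tau> * cnj \<tau>) (s * cnj_poly s)"
      by (simp add: cnj_poly_add cnj_poly_smult cnj_poly_mult algebra_simps)
    then have "moment c (?p * cnj_poly ?p) = moment c (g * cnj_poly g) + \<tau> * u + cnj (\<tau> * u)"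
      using assms(2) by (simp add: moment_add moment_smult moment_cnj_poly u_def)
    then have "Re (moment c (?p * cnj_poly ?p)) = A + 2 * Re (\<tau> * u)"
      by (simp add: A_def)
    also have "\<tau> * u = - of_real (k * (cmod u)\<^sup>2)"
      by (simp add: \<tau>_def complex_norm_square del: of_real_power)
    finally show ?thesis
      using moment_mult_cnj_nonneg[OF assms(1), of ?p] by (auto simp: complex_nonneg_Reals_iff)
  qed
  have "u = 0"
  proof (rule ccontr)
    assume "u \<noteq> 0"
    then have "2 * ((A + 1) / (2 * (cmod u)\<^sup>2)) * (cmod u)\<^sup>2 = A + 1" by simp
    with le[of "(A + 1) / (2 * (cmod u)\<^sup>2)"] show False by simp
  qed
  then show ?thesis by (simp add: u_def)
qed

section \<open>Orthogonal polynomials and their zeros\<close>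

lemma exists_orthogonal_poly:
  "\<exists>q::complex poly. q \<noteq> 0 \<and> degree q \<le> m \<and> (\<forall>g. degree g < m \<longrightarrow> moment c (q * g) = 0)"
proof -
  \<comment> \<open>Orthogonality to \<open>1, t, ..., t ^ (m - 1)\<close> gives \<open>m\<close>
    linear equations for \<open>m + 1\<close> coefficients.\<close>
  obtain x :: "nat \<Rightarrow> complex" where x: "\<exists>k\<in>{..m}. x k \<noteq> 0"
    "\<forall>i\<in>{..<m}. (\<Sum>k\<in>{..m}. of_real (c (i + k)) * x k) = 0"
    using exists_homogeneous_solution[of "{..<m}" "{..m}" "\<lambda>i k. of_real (c (i + k))"] by auto
  define q where "q = (\<Sum>k\<le>m. monom (x k) k)"
  have coeff_q: "coeff q k = (if k \<le> m then x k else 0)" for k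
    by (auto simp: q_def coeff_sum coeff_monom sum.delta)
  have "q \<noteq> 0" using x(1) coeff_q by (metis atMost_iff coeff_0)
  moreover have deg: "degree q \<le> m" by (rule degree_le) (simp add: coeff_q)
  moreover have "moment c (q * g) = 0" if "degree g < m" for g
  proof -
    have "moment c (monom 1 i * q) = 0" if "i < m" for i
      unfolding moment_monom_mult using x(2) that
      by (subst moment_eq_sum[OF deg]) (simp add: coeff_q scaleR_conv_of_real add.commute[of _ i])
    moreover have "q * g = (\<Sum>i\<le>degree g. smult (coeff g i) (monom 1 i * q))"
    proof -
      have "q * g = q * (\<Sum>i\<le>degree g. smult (coeff g i) (monom 1 i))"
        by (simp add: smult_monom poly_as_sum_of_monoms)
      also have "\<dots> = (\<Sum>i\<le>degree g. smult (coeff g i) (monom 1 i * q))"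
        by (simp only: sum_distrib_left mult_smult_right mult.commute[of q])
      finally show ?thesis .
    qed
    ultimately show ?thesis using that by (simp add: moment_sum moment_smult)
  qed
  ultimately show ?thesis by blast
qed

text \<open>Choosing the orthogonal polynomial of minimal degree also covers measures with fewer than
  \<open>m\<close> points of support.\<close>

lemma exists_quadrature_poly:
  assumes c: "hausdorff c"
  obtains X :: "real set" where "finite X" "card X \<le> m" "X \<subseteq> {0..1}"
    "\<And>g. degree g + card X < 2 * m \<Longrightarrow> moment c ((\<Prod>x\<in>X. [:- of_real x, 1:]) * g) = (0::complex)"
proof -
  define Orth where "Orth q \<longleftrightarrow> q \<noteq> 0 \<and> degree q \<le> m \<and> (\<forall>g. degree g < m \<longrightarrow> moment c (q * g) = 0)"
    for q :: "complex poly"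
  obtain q where q: "Orth q" and min: "\<And>p. Orth p \<Longrightarrow> degree q \<le> degree p"
  proof -
    have "\<exists>q. Orth q" using exists_orthogonal_poly[of m c] by (simp add: Orth_def)
    then show ?thesis using ex_has_least_nat[of Orth _ degree] that by blast
  qed
  \<comment> \<open>The form is definite below the degree of \<open>q\<close>: a nonzero null
    \<open>s\<close> would be orthogonal to everything and so contradict minimality.\<close>
  have null: "s = 0" if "moment c (s * cnj_poly s) = 0" "degree s < degree q" for s
  proof (rule ccontr)
    assume "s \<noteq> 0"
    then have "Orth s"
      using moment_cauchy_schwarz_null[OF c that(1)] that(2) q by (auto simp: Orth_def)
    then show False using min[of s] that(2) by simp
  qed
  have root: "z \<in> of_real ` {0..1}" and simple: "poly s z \<noteq> 0" if qs: "q = [:- z, 1:] * s" for z s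
  proof -
    have s: "s \<noteq> 0" using q qs by (auto simp: Orth_def)
    then have "degree q = Suc (degree s)" unfolding qs by (subst degree_mult_eq) auto
    then have deg_s: "degree s < degree q" by simp
    \<comment> \<open>Testing \<open>q\<close> against \<open>cnj_poly s\<close> gives
      \<open>t = z * n\<close>, so the root is the centre of mass of the weight
      \<open>|s|^2\<close>. Positivity for the weights \<open>x |s|^2\<close> and
      \<open>(1 - x) |s|^2\<close> places it in \<open>[0,1]\<close>.\<close>
    define n where "n = moment c (s * cnj_poly s)"
    define t where "t = moment c ([:0, 1:] * (s * cnj_poly s))"
    have "moment c (q * cnj_poly s) = 0"
      using q deg_s by (auto simp: Orth_def)
    also have "q * cnj_poly s = [:0, 1:] * (s * cnj_poly s) - smult z (s * cnj_poly s)"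
      by (simp add: qs algebra_simps)
    finally have t_eq: "t = z * n" by (simp add: moment_diff moment_smult t_def n_def)
    have n: "n \<in> \<real>\<^sub>\<ge>\<^sub>0" unfolding n_def by (rule moment_mult_cnj_nonneg[OF c])
    have n_neq_0: "n \<noteq> 0" using null[of s] s deg_s by (auto simp: n_def)
    have poly_eq: "poly (p * (s * cnj_poly s)) (of_real x) = poly p (of_real x) * of_real ((cmod (poly s x))\<^sup>2)"
      for p x by (simp only: poly_mult[of p] poly_mult_cnj_poly)
    have t: "t \<in> \<real>\<^sub>\<ge>\<^sub>0" unfolding t_def
    proof (rule hausdorff_moment_nonneg[OF c])
      fix x :: real assume "x \<in> {0..1}"
      then show "poly ([:0, 1:] * (s * cnj_poly s)) (complex_of_real x) \<in> \<real>\<^sub>\<ge>\<^sub>0"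
        unfolding poly_eq by (auto intro!: nonneg_Reals_mult_I)
    qed
    have "moment c ([:1, -1:] * (s * cnj_poly s)) \<in> \<real>\<^sub>\<ge>\<^sub>0"
    proof (rule hausdorff_moment_nonneg[OF c])
      fix x :: real assume "x \<in> {0..1}"
      then have "poly [:1, -1:] (complex_of_real x) = of_real (1 - x)" "0 \<le> 1 - x" by auto
      then show "poly ([:1, -1:] * (s * cnj_poly s)) (complex_of_real x) \<in> \<real>\<^sub>\<ge>\<^sub>0"
        unfolding poly_eq by (metis nonneg_Reals_mult_I nonneg_Reals_of_real_iff zero_le_power2)
    qed
    also have "[:1, -1:] * (s * cnj_poly s) = s * cnj_poly s - [:0, 1:] * (s * cnj_poly s)"
      by (simp add: algebra_simps)
    finally have nt: "n - t \<in> \<real>\<^sub>\<ge>\<^sub>0" by (simp add: moment_diff n_def t_def)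
    obtain n' t' where n't': "n = of_real n'" "t = of_real t'" "0 \<le> n'" "0 \<le> t'" "t' \<le> n'"
      using n t nt by (auto simp: complex_nonneg_Reals_iff complex_eq_iff
          intro!: that[of "Re n" "Re t"])
    have "z = of_real (t' / n')" using t_eq n_neq_0 n't' by (simp add: field_simps)
    moreover have "t' / n' \<in> {0..1}" using n't' n_neq_0 by (auto simp: divide_le_eq_1)
    ultimately show z: "z \<in> of_real ` {0..1}" by blast
    \<comment> \<open>At a double root, \<open>z\<close> being real, one factor can be moved from
      \<open>cnj_poly s\<close> to \<open>s\<close>, so that
      \<open>s * cnj_poly s = q * cnj_poly s'\<close>. Orthogonality then makes \<open>s\<close>
      null.\<close>
    show "poly s z \<noteq> 0"
    proof
      assume "poly s z = 0"
      then obtain s' where s': "s = [:- z, 1:] * s'" by (metis dvdE poly_eq_0_iff_dvd)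
      have "cnj_poly [:- z, 1:] = [:- z, 1:]" using z by (auto simp: map_poly_pCons)
      then have "s * cnj_poly s = q * cnj_poly s'"
        by (simp only: qs s' cnj_poly_mult mult_ac)
      moreover have "degree s' < m"
      proof -
        have "s' \<noteq> 0" using s s' by auto
        then have "degree s = Suc (degree s')" unfolding s' by (subst degree_mult_eq) auto
        then show ?thesis using deg_s q by (simp add: Orth_def)
      qed
      ultimately have "moment c (s * cnj_poly s) = 0"
        using q by (simp add: Orth_def)
      then show False using null[of s] s deg_s by blast
    qed
  qed
  define Z where "Z = {z. poly q z = 0}"
  have Z_real: "Z \<subseteq> of_real ` {0..1}"
    using root by (auto simp: Z_def poly_eq_0_iff_dvd dvd_def)
  have order_1: "order z q = 1" if "z \<in> Z" for z
  proof -
    obtain s where s: "q = [:- z, 1:] * s" using \<open>z \<in> Z\<close> by (auto simp: Z_def poly_eq_0_iff_dvd dvd_def)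
    have "order z q = order z [:- z, 1:] + order z s"
      using q unfolding s by (intro order_mult) (auto simp: Orth_def s)
    also have "order z s = 0" using simple[OF s] by (simp add: order_root)
    finally show ?thesis using order_power_n_n[of z 1] by simp
  qed
  define X where "X = Re ` Z"
  have fin_Z: "finite Z" unfolding Z_def using q by (simp add: Orth_def poly_roots_finite)
  have Z_eq: "Z = of_real ` X" using Z_real by (force simp: X_def)
  have q_eq: "q = smult (lead_coeff q) (\<Prod>x\<in>X. [:- of_real x, 1:])"
  proof -
    have "q = smult (lead_coeff q) (\<Prod>z\<in>Z. [:- z, 1:] ^ order z q)"
      using complex_poly_decompose[of q] by (simp add: Z_def)
    also have "(\<Prod>z\<in>Z. [:- z, 1:] ^ order z q) = (\<Prod>z\<in>Z. [:- z, 1:])"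
      by (intro prod.cong) (auto simp: order_1)
    also have "\<dots> = (\<Prod>x\<in>X. [:- of_real x, 1:])"
      unfolding Z_eq by (subst prod.reindex) (auto simp: inj_on_def)
    finally show ?thesis .
  qed
  have lc: "lead_coeff q \<noteq> 0" using q by (simp add: Orth_def)
  have deg_q: "degree q = card X"
    by (subst q_eq) (use lc in \<open>simp add: degree_prod_eq_sum_degree\<close>)
  have X01: "X \<subseteq> {0..1}" using Z_real by (auto simp: X_def)
  \<comment> \<open>If \<open>degree q < m\<close>, then \<open>cnj_poly q\<close> is itself an
    admissible test polynomial, so \<open>q\<close> is null and orthogonal to everything. Otherwise
    \<open>card X = m\<close>, and the bound says \<open>degree g < m\<close>.\<close>
  have exact: "moment c (q * g) = 0" if "degree g + card X < 2 * m" for g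
  proof (cases "degree q < m")
    case True
    then have "moment c (q * cnj_poly q) = 0" using q by (simp add: Orth_def)
    then show ?thesis by (rule moment_cauchy_schwarz_null[OF c])
  next
    case False
    then show ?thesis using q deg_q that by (auto simp: Orth_def)
  qed
  have "moment c ((\<Prod>x\<in>X. [:- of_real x, 1:]) * g) = 0" if "degree g + card X < 2 * m"
    for g :: "complex poly"
    using exact[OF that] lc by (subst (asm) q_eq) (simp add: moment_smult)
  then show ?thesis
    using that[of X] fin_Z X01 q deg_q by (auto simp: X_def Orth_def)
qed

text \<open>The nodes are the zeros found above and the weights are the moments of the Lagrange
  basis polynomials \<open>L x\<close>.\<close>

lemma gauss_quadrature:
  assumes c: "hausdorff c" and "0 < m"
  obtains X :: "real set" and w :: "real \<Rightarrow> real" where "finite X" "card X \<le> m" "X \<subseteq> {0..1}"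
    "\<And>x. 0 \<le> w x" "\<And>n. n < 2 * m \<Longrightarrow> c n = (\<Sum>x\<in>X. w x * x ^ n)"
proof -
  obtain X where X: "finite X" "card X \<le> m" "X \<subseteq> {0..1}" and
    exact: "\<And>g. degree g + card X < 2 * m \<Longrightarrow> moment c ((\<Prod>x\<in>X. [:- of_real x, 1:]) * g) = (0::complex)"
    using exists_quadrature_poly[OF c] by metis
  define Q :: "complex poly" where "Q = (\<Prod>x\<in>X. [:- of_real x, 1:])"
  define L :: "real \<Rightarrow> complex poly" where
    "L x = smult (1 / (\<Prod>y\<in>X - {x}. of_real x - of_real y)) (\<Prod>y\<in>X - {x}. [:- of_real y, 1:])" for x
  have L_same: "poly (L x) (of_real x) = 1" if "x \<in> X" for x
    using X(1) by (simp add: L_def poly_prod)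
  have L_other: "poly (L x) (of_real y) = 0" if "x \<in> X" "y \<in> X" "x \<noteq> y" for x y
    using X(1) that by (auto simp: L_def poly_prod)
  have deg_L: "degree (L x) < card X" if "x \<in> X" for x
  proof -
    have "degree (L x) \<le> card (X - {x})"
      unfolding L_def
      by (rule order.trans[OF degree_smult_le]) (simp add: degree_prod_eq_sum_degree)
    also have "\<dots> < card X" using X that by (intro psubset_card_mono) auto
    finally show ?thesis .
  qed
  have cnj_L: "poly (cnj_poly (L x)) (of_real y) = cnj (poly (L x) (of_real y))" for x y
    by (simp add: poly_altdef coeff_map_poly)
  have quad: "moment c p = (\<Sum>x\<in>X. poly p (of_real x) * moment c (L x))" if deg: "degree p < 2 * m" for p
  proof -
    \<comment> \<open>Division by the node polynomial: orthogonality removes \<open>Q * g\<close>,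
      and the remainder, of degree below \<open>card X\<close> or zero, is recovered from its values
      at the nodes, where it agrees with \<open>p\<close>.\<close>
    define g where "g = p div Q"
    define r where "r = p mod Q"
    have p: "p = Q * g + r" by (simp add: g_def r_def)
    have Q: "Q \<noteq> 0" "degree Q = card X"
      using X(1) by (auto simp: Q_def degree_prod_eq_sum_degree)
    have poly_Q: "poly Q (of_real x) = 0" if "x \<in> X" for x
      using X(1) that by (auto simp: Q_def poly_prod)
    have r: "r = 0 \<or> degree r < card X"
      using degree_mod_less[of Q p] Q by (auto simp: r_def)
    have "degree g + card X < 2 * m"
    proof (cases "g = 0")
      case False
      then have "degree (Q * g) = card X + degree g" using Q by (simp add: degree_mult_eq)
      then have "degree p = card X + degree g"
        using r by (auto simp: p degree_add_eq_left)
      then show ?thesis using deg by simp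
    qed (use X assms(2) in auto)
    then have "moment c p = moment c r"
      using exact[of g] by (simp add: p moment_add Q_def)
    also have "r = (\<Sum>x\<in>X. smult (poly r (of_real x)) (L x))"
    proof (cases "X = {}")
      case True
      then show ?thesis using r by simp
    next
      case False
      then have card_pos: "0 < card X" using X(1) by (simp add: card_gt_0_iff)
      have card_eq: "card (complex_of_real ` X) = card X" by (simp add: card_image inj_on_def)
      show ?thesis
      proof (rule poly_eqI_degree[of "complex_of_real ` X"])
        fix z assume "z \<in> complex_of_real ` X"
        then obtain y where y: "z = of_real y" "y \<in> X" by auto
        have "(\<Sum>x\<in>X. poly r (of_real x) * poly (L x) (of_real y))
            = (\<Sum>x\<in>X. if x = y then poly r (of_real y) else 0)"
          using L_same L_other y by (intro sum.cong) auto
        then show "poly r z = poly (\<Sum>x\<in>X. smult (poly r (of_real x)) (L x)) z"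
          using X y by (simp add: poly_sum)
      next
        show "degree r < card (complex_of_real ` X)" using r card_pos card_eq by auto
        show "degree (\<Sum>x\<in>X. smult (poly r (of_real x)) (L x)) < card (complex_of_real ` X)"
          unfolding card_eq
          by (intro degree_sum_less) (auto intro: order.strict_trans1[OF degree_smult_le] deg_L card_pos)
      qed
    qed
    also have "moment c \<dots> = (\<Sum>x\<in>X. poly r (of_real x) * moment c (L x))"
      by (simp add: moment_sum moment_smult)
    also have "\<dots> = (\<Sum>x\<in>X. poly p (of_real x) * moment c (L x))"
      by (intro sum.cong) (auto simp: p poly_Q)
    finally show ?thesis .
  qed
  \<comment> \<open>\<open>L x * cnj_poly (L x)\<close> is \<open>1\<close> at \<open>x\<close>,
    \<open>0\<close> at the other nodes and of degree below \<open>2 * m\<close>. The rule is exact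
    on it, so the weight is the moment of a polynomial nonnegative on \<open>[0,1]\<close>.\<close>
  have nonneg: "moment c (L x) \<in> \<real>\<^sub>\<ge>\<^sub>0" if x: "x \<in> X" for x
  proof -
    have "degree (L x * cnj_poly (L x)) < 2 * m"
      using degree_mult_le[of "L x" "cnj_poly (L x)"] deg_L[OF x] X by simp
    then have "moment c (L x * cnj_poly (L x))
        = (\<Sum>y\<in>X. poly (L x * cnj_poly (L x)) (of_real y) * moment c (L y))"
      by (rule quad)
    also have "\<dots> = (\<Sum>y\<in>X. if y = x then moment c (L x) else 0)"
      using L_same L_other x by (intro sum.cong) auto
    also have "\<dots> = moment c (L x)" using X x by simp
    finally show ?thesis using moment_mult_cnj_nonneg[OF c, of "L x"] by simp
  qed
  define w where "w x = (if x \<in> X then Re (moment c (L x)) else 0)" for x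
  have w_eq: "moment c (L x) = of_real (w x)" if "x \<in> X" for x
    using nonneg[OF that] that by (simp add: w_def complex_nonneg_Reals_iff complex_eq_iff)
  have w_nonneg: "0 \<le> w x" for x
    using nonneg by (simp add: w_def complex_nonneg_Reals_iff)
  have "c n = (\<Sum>x\<in>X. w x * x ^ n)" if n: "n < 2 * m" for n
  proof -
    have "complex_of_real (c n) = moment c (monom 1 n :: complex poly)"
      by (simp add: moment_monom scaleR_conv_of_real)
    also have "\<dots> = (\<Sum>x\<in>X. poly (monom 1 n) (of_real x) * moment c (L x))"
      by (rule quad) (use n degree_monom_le[of "1::complex" n] in simp)
    also have "\<dots> = of_real (\<Sum>x\<in>X. w x * x ^ n)"
      by (simp add: poly_monom w_eq mult.commute)
    finally show ?thesis by (simp only: of_real_eq_iff)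
  qed
  with X w_nonneg that show ?thesis by blast
qed

subsection \<open>Convergence of the quadrature sums\<close>

definition quadrature :: "(nat \<Rightarrow> real) \<Rightarrow> nat \<Rightarrow> real set \<Rightarrow> (real \<Rightarrow> real) \<Rightarrow> bool" where
  "quadrature c m X w \<longleftrightarrow> finite X \<and> card X \<le> m \<and> X \<subseteq> {0..1} \<and> (\<forall>x. 0 \<le> w x) \<and>
     (\<forall>n<2 * m. c n = (\<Sum>x\<in>X. w x * x ^ n))"

text \<open>The Stieltjes transform of the discrete measure with masses \<open>w x\<close> at the
  points \<open>x\<close>.\<close>

definition stieltjes_sum :: "real set \<Rightarrow> (real \<Rightarrow> real) \<Rightarrow> complex \<Rightarrow> complex" where
  "stieltjes_sum X w z = (\<Sum>x\<in>X. of_real (w x) / (1 + of_real x * z))"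

abbreviation cut_plane :: "complex set" where
  "cut_plane \<equiv> - complex_of_real ` {..-1}"

lemma cut_plane_kernel_neq_0:
  assumes "z \<in> cut_plane" and "t \<in> {0..1}"
  shows "1 + complex_of_real t * z \<noteq> 0"
proof
  assume eq: "1 + complex_of_real t * z = 0"
  then have "t \<noteq> 0" by auto
  have "complex_of_real t * z = - 1" using eq by (simp add: eq_neg_iff_add_eq_0 add.commute)
  with \<open>t \<noteq> 0\<close> have "z = of_real (- 1 / t)" by (simp add: field_simps)
  moreover have "- 1 / t \<le> -1" using assms(2) \<open>t \<noteq> 0\<close> by (simp add: field_simps)
  ultimately show False using assms(1) by blast
qed

lemma closed_cut: "closed (complex_of_real ` {..-1})"
proof -
  have "complex_of_real ` {..-1} = {z. Im z = 0 \<and> Re z \<le> -1}"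
    by (auto simp: complex_eq_iff image_iff)
  also have "closed \<dots>" by (intro closed_Collect_conj closed_Collect_eq closed_Collect_le continuous_intros)
  finally show ?thesis .
qed

text \<open>The segment from \<open>1\<close> to \<open>1 + z\<close> is convex and misses \<open>0\<close>, so it lies in a disc around
  \<open>1 / \<gamma>\<close> that misses \<open>0\<close>, where \<open>\<gamma>\<close> is a multiple of the conjugate of its point closest
  to \<open>0\<close>; on it, \<open>1 / (1 + t z)\<close> is a geometric series in \<open>1 - \<gamma> (1 + t z)\<close>.\<close>

lemma uniform_poly_approx_kernel:
  assumes K: "compact K" "K \<subseteq> cut_plane" and "0 < \<epsilon>"
  obtains N where "\<And>z. z \<in> K \<Longrightarrow> \<exists>p. degree p \<le> N \<and>
    (\<forall>t\<in>{0..1}. cmod (1 / (1 + of_real t * z) - poly p (of_real t)) \<le> \<epsilon>)"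
proof -
  let ?k = "\<lambda>(z, t). 1 / (1 + complex_of_real t * z)"
  have "continuous_on (K \<times> {0..1::real}) ?k"
    unfolding split_def
    by (intro continuous_intros) (use K(2) cut_plane_kernel_neq_0 in force)
  then have "bounded (?k ` (K \<times> {0..1}))"
    using K(1) by (intro compact_imp_bounded compact_continuous_image compact_Times) auto
  then obtain C0 where C0: "\<forall>y\<in>?k ` (K \<times> {0..1}). cmod y \<le> C0"
    by (auto simp: bounded_iff)
  \<comment> \<open>Raising the bound to at least \<open>1\<close> gives
    \<open>1 < C^2 * M^2\<close> below, so that the ratio \<open>\<rho>\<close> is a real number in
    \<open>[0,1)\<close>.\<close>
  define C where "C = max 1 C0"
  have C: "1 \<le> C" by (simp add: C_def)
  have kernel_le: "cmod (1 / (1 + of_real t * z)) \<le> C" if "z \<in> K" "t \<in> {0..1}" for z t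
  proof -
    have "1 / (1 + of_real t * z) \<in> ?k ` (K \<times> {0..1})"
      by (rule image_eqI[of _ _ "(z, t)"]) (use that in auto)
    then have "cmod (1 / (1 + of_real t * z)) \<le> C0" using C0 by blast
    then show ?thesis by (simp add: C_def)
  qed
  obtain D where D: "0 < D" "\<And>z. z \<in> K \<Longrightarrow> cmod z \<le> D"
    using compact_imp_bounded[OF K(1)] by (auto simp: bounded_pos)
  define M where "M = 1 + D"
  have M: "1 < M" using D by (simp add: M_def)
  have le_M: "cmod (1 + of_real t * z) \<le> M" if "z \<in> K" "t \<in> {0..1}" for z t
  proof -
    have "cmod (1 + of_real t * z) \<le> cmod 1 + cmod (of_real t * z)" by (rule norm_triangle_ineq)
    also have "cmod (of_real t * z) \<le> 1 * D"
      unfolding norm_mult using that D by (intro mult_mono) auto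
    finally show ?thesis by (simp add: M_def)
  qed
  \<comment> \<open>Ratio of the geometric series, uniform in \<open>z\<close> and \<open>t\<close>:
    below, \<open>|1 - \<gamma> v|^2 \<le> 1 - |p0|^2 / M^2\<close>, and
    \<open>|p0| \<ge> 1 / C\<close>.\<close>
  define \<rho> where "\<rho> = sqrt (1 - 1 / (C\<^sup>2 * M\<^sup>2))"
  have CM: "1 < C\<^sup>2 * M\<^sup>2"
    using less_1_mult'[of "M\<^sup>2" "C\<^sup>2"] one_less_power[of M 2] one_le_power[of C 2] C M
    by (simp add: mult.commute)
  have \<rho>: "0 \<le> \<rho>" "\<rho> < 1" and \<rho>2: "\<rho>\<^sup>2 = 1 - 1 / (C\<^sup>2 * M\<^sup>2)"
    using CM by (auto simp: \<rho>_def field_simps real_less_lsqrt)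
  obtain N where N: "\<rho> ^ N < \<epsilon> / C"
    using real_arch_pow_inv[of "\<epsilon> / C" \<rho>] \<rho> C \<open>0 < \<epsilon>\<close> by auto
  have "\<exists>p. degree p \<le> N \<and> (\<forall>t\<in>{0..1}. cmod (1 / (1 + of_real t * z) - poly p (of_real t)) \<le> \<epsilon>)"
    if z: "z \<in> K" for z
  proof -
    define S where "S = (\<lambda>t. 1 + complex_of_real t * z) ` {0..1}"
    have "S = closed_segment 1 (1 + z)"
      unfolding S_def closed_segment_image_interval by (intro image_cong) (auto simp: scaleR_conv_of_real algebra_simps)
    then have S: "convex S" "closed S" "S \<noteq> {}" by auto
    define p0 where "p0 = closest_point S 0"
    have "p0 \<in> S" unfolding p0_def using S by (intro closest_point_in_set) auto
    then obtain t0 where t0: "p0 = 1 + of_real t0 * z" "t0 \<in> {0..1}"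
      unfolding S_def by blast
    have p0_neq_0: "p0 \<noteq> 0"
      unfolding t0(1) by (rule cut_plane_kernel_neq_0[OF subsetD[OF K(2) z] t0(2)])
    have p0_ge: "1 \<le> (cmod p0)\<^sup>2 * C\<^sup>2"
    proof -
      have "1 \<le> cmod p0 * C"
        using kernel_le[OF z t0(2), folded t0(1)] p0_neq_0
        by (simp add: norm_divide pos_divide_le_eq mult.commute)
      then have "1 \<le> (cmod p0 * C)\<^sup>2" by (rule one_le_power)
      then show ?thesis by (simp add: power_mult_distrib)
    qed
    define \<gamma> where "\<gamma> = cnj p0 / of_real (M\<^sup>2)"
    have contr: "cmod (1 - \<gamma> * (1 + of_real t * z)) \<le> \<rho>" if t: "t \<in> {0..1}" for t
    proof -
      define v where "v = 1 + of_real t * z"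
      have "v \<in> S" using t by (auto simp: S_def v_def)
      \<comment> \<open>Variational inequality of the projection: \<open>S\<close> lies in the
        half-plane \<open>Re (cnj p0 * v) \<ge> |p0|^2\<close>.\<close>
      then have "inner (0 - p0) (v - p0) \<le> 0"
        unfolding p0_def using S by (intro closest_point_dot) auto
      then have "(cmod p0)\<^sup>2 \<le> inner p0 v"
        by (simp add: inner_diff_right power2_norm_eq_inner)
      then have inner_ge: "(cmod p0)\<^sup>2 \<le> Re (cnj p0 * v)"
        by (simp add: inner_complex_def)
      have cmod_v: "cmod v \<le> M" using le_M[OF z t] by (simp add: v_def)
      have \<gamma>v: "\<gamma> * v = (cnj p0 * v) / of_real (M\<^sup>2)" by (simp add: \<gamma>_def)
      have "(cmod (1 - \<gamma> * v))\<^sup>2 = 1 - 2 * Re (\<gamma> * v) + (cmod (\<gamma> * v))\<^sup>2"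
        unfolding cmod_power2 by (simp add: power2_eq_square algebra_simps)
      also have "\<dots> = 1 - 2 * (Re (cnj p0 * v) / M\<^sup>2) + (cmod p0)\<^sup>2 / M\<^sup>2 * ((cmod v)\<^sup>2 / M\<^sup>2)"
        by (simp only: \<gamma>v Re_divide_of_real norm_divide norm_mult complex_mod_cnj norm_of_real)
           (simp add: power_divide power_mult_distrib power2_eq_square)
      also have "\<dots> \<le> 1 - 2 * ((cmod p0)\<^sup>2 / M\<^sup>2) + (cmod p0)\<^sup>2 / M\<^sup>2 * 1"
      proof -
        have "(cmod p0)\<^sup>2 / M\<^sup>2 \<le> Re (cnj p0 * v) / M\<^sup>2"
          using inner_ge by (rule divide_right_mono) simp
        moreover have "(cmod p0)\<^sup>2 / M\<^sup>2 * ((cmod v)\<^sup>2 / M\<^sup>2) \<le> (cmod p0)\<^sup>2 / M\<^sup>2 * 1"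
          using cmod_v M by (intro mult_left_mono) (auto simp: power_mono divide_le_eq_1)
        ultimately show ?thesis by linarith
      qed
      also have "\<dots> = 1 - (cmod p0)\<^sup>2 / M\<^sup>2" by simp
      also have "\<dots> \<le> \<rho>\<^sup>2"
        using p0_ge C M unfolding \<rho>2 by (simp add: field_simps)
      finally show ?thesis unfolding v_def by (rule power2_le_imp_le) (rule \<rho>(1))
    qed
    let ?p = "smult \<gamma> (\<Sum>n<N. [:1 - \<gamma>, - (\<gamma> * z):] ^ n)"
    have "degree ?p \<le> N"
    proof (rule order.trans[OF degree_smult_le degree_sum_le])
      fix n assume "n \<in> {..<N}"
      then show "degree ([:1 - \<gamma>, - (\<gamma> * z):] ^ n) \<le> N"
        using degree_power_le[of "[:1 - \<gamma>, - (\<gamma> * z):]" n] by (auto split: if_splits)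
    qed simp
    moreover have "cmod (1 / (1 + of_real t * z) - poly ?p (of_real t)) \<le> \<epsilon>" if t: "t \<in> {0..1}" for t
    proof -
      define v where "v = 1 + of_real t * z"
      define y where "y = 1 - \<gamma> * v"
      have v: "v \<noteq> 0" 
        unfolding v_def by (rule cut_plane_kernel_neq_0[OF subsetD[OF K(2) z] t])
      have poly_p: "poly ?p (of_real t) = \<gamma> * (\<Sum>n<N. y ^ n)"
        by (simp add: poly_sum y_def v_def algebra_simps)
      have "v * poly ?p (of_real t) = (1 - y) * (\<Sum>n<N. y ^ n)"
        unfolding poly_p y_def by (simp add: mult_ac)
      also have "\<dots> = 1 - y ^ N" by (rule one_diff_power_eq[symmetric])
      finally have "1 / v - poly ?p (of_real t) = y ^ N * (1 / v)"
        using v by (simp add: field_simps)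
      also have "cmod \<dots> \<le> \<rho> ^ N * C"
        unfolding norm_mult norm_power y_def v_def using contr[OF t] kernel_le[OF z t] \<rho>
        by (intro mult_mono power_mono) auto
      also have "\<dots> \<le> \<epsilon>" using N C by (simp add: field_simps)
      finally show ?thesis by (simp add: v_def)
    qed
    ultimately show ?thesis by blast
  qed
  then show ?thesis by (rule that)
qed

text \<open>By exactness, \<open>moment c p\<close> is the quadrature sum of \<open>p\<close>. The
  error is then at most \<open>\<epsilon>\<close> times the total weight, which is
  \<open>c 0\<close> by exactness in degree \<open>0\<close>. The comparison value does not depend
  on the rule.\<close>

lemma quadrature_approx:
  assumes quad: "quadrature c m X w" and "degree p < 2 * m"
    and le: "\<And>t. t \<in> {0..1} \<Longrightarrow> cmod (1 / (1 + of_real t * z) - poly p (of_real t)) \<le> \<epsilon>"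
  shows "cmod (stieltjes_sum X w z - moment c p) \<le> c 0 * \<epsilon>"
proof -
  have "moment c p = (\<Sum>i\<le>degree p. \<Sum>x\<in>X. of_real (w x) * (of_real x ^ i * coeff p i))"
    unfolding moment_def
  proof (intro sum.cong refl)
    fix i assume "i \<in> {..degree p}"
    then have "c i = (\<Sum>x\<in>X. w x * x ^ i)" using quad assms(2) by (auto simp: quadrature_def)
    then show "c i *\<^sub>R coeff p i = (\<Sum>x\<in>X. of_real (w x) * (of_real x ^ i * coeff p i))"
      by (simp add: scaleR_conv_of_real sum_distrib_right mult.assoc)
  qed
  also have "\<dots> = (\<Sum>x\<in>X. of_real (w x) * poly p (of_real x))"
    by (subst sum.swap) (simp add: poly_altdef sum_distrib_left mult_ac)
  finally have "stieltjes_sum X w z - moment c p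
      = (\<Sum>x\<in>X. of_real (w x) * (1 / (1 + of_real x * z) - poly p (of_real x)))"
    by (simp add: stieltjes_sum_def right_diff_distrib sum_subtractf)
  also have "cmod \<dots> \<le> (\<Sum>x\<in>X. w x * \<epsilon>)"
  proof (rule sum_norm_le)
    fix x assume "x \<in> X"
    then show "cmod (of_real (w x) * (1 / (1 + of_real x * z) - poly p (of_real x))) \<le> w x * \<epsilon>"
      unfolding norm_mult using quad le[of x] by (intro mult_mono) (auto simp: quadrature_def)
  qed
  also have "\<dots> = c 0 * \<epsilon>"
    using quad assms(2) by (simp add: quadrature_def sum_distrib_right)
  finally show ?thesis .
qed

text \<open>The approximating polynomial is the partial geometric sum in \<open>- t z\<close>, of
  degree below \<open>2 * m\<close>. The case \<open>N = 2 * m\<close> gives the order of contact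
  that a Pade approximant requires.\<close>

lemma quadrature_power_series:
  assumes quad: "quadrature c m X w" and z: "cmod z < 1" and N: "N \<le> 2 * m" and "0 < m"
  shows "cmod (stieltjes_sum X w z - (\<Sum>i<N. of_real (c i) * (- z) ^ i))
    \<le> c 0 * (cmod z ^ N / (1 - cmod z))"
proof -
  let ?p = "\<Sum>i<N. monom ((- z) ^ i) i"
  have "degree ?p < 2 * m"
    using N \<open>0 < m\<close> by (intro degree_sum_less) (auto intro: order.strict_trans1[OF degree_monom_le])
  then have "cmod (stieltjes_sum X w z - moment c ?p) \<le> c 0 * (cmod z ^ N / (1 - cmod z))"
  proof (rule quadrature_approx[OF quad])
    fix t :: real assume t: "t \<in> {0..1}"
    define y where "y = - (of_real t * z)"
    have y_le: "cmod y \<le> cmod z"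
      using t by (simp add: y_def norm_mult mult_left_le_one_le)
    have norm_ge: "1 - cmod z \<le> cmod (1 - y)"
      using y_le norm_triangle_ineq2[of 1 y] by simp
    then have "1 - y \<noteq> 0" using z by auto
    have "poly ?p (of_real t) = (\<Sum>i<N. y ^ i)"
      by (simp add: poly_sum poly_monom y_def mult.commute flip: power_mult_distrib)
    then have "(1 - y) * poly ?p (of_real t) = 1 - y ^ N" by (simp add: one_diff_power_eq)
    then have "1 / (1 - y) - poly ?p (of_real t) = y ^ N / (1 - y)"
      using \<open>1 - y \<noteq> 0\<close> by (simp add: field_simps)
    also have "cmod \<dots> \<le> cmod z ^ N / (1 - cmod z)"
      unfolding norm_divide norm_power using y_le norm_ge z by (intro frac_le power_mono) auto
    finally show "cmod (1 / (1 + of_real t * z) - poly ?p (of_real t)) \<le> cmod z ^ N / (1 - cmod z)"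
      by (simp add: y_def)
  qed
  then show ?thesis
    by (simp add: moment_sum moment_monom scaleR_conv_of_real)
qed

text \<open>Two rules of large order are both close to the same \<open>moment c p\<close>, so the
  sums are uniformly Cauchy on compact sets. The limit inherits holomorphy and the bound against
  partial sums, which identifies its Taylor series.\<close>

lemma stieltjes_limit:
  assumes quad: "\<And>m. quadrature c m (X m) (w m)"
  obtains G where "G holomorphic_on cut_plane"
    "\<And>K. compact K \<Longrightarrow> K \<subseteq> cut_plane \<Longrightarrow> uniform_limit K (\<lambda>m. stieltjes_sum (X m) (w m)) G sequentially"
    "\<And>z N. cmod z < 1 \<Longrightarrow>
      cmod (G z - (\<Sum>i<N. of_real (c i) * (- z) ^ i)) \<le> c 0 * (cmod z ^ N / (1 - cmod z))"
proof -
  let ?S = "\<lambda>m. stieltjes_sum (X m) (w m)"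
  have c0: "0 \<le> c 0" using quad[of 1] by (auto simp: quadrature_def intro!: sum_nonneg)
  define G where "G z = lim (\<lambda>m. ?S m z)" for z
  have unif: "uniform_limit K ?S G sequentially" if K: "compact K" "K \<subseteq> cut_plane" for K
  proof -
    have "uniformly_Cauchy_on K ?S"
    proof (rule uniformly_Cauchy_onI)
      fix e :: real assume "0 < e"
      \<comment> \<open>The factor \<open>2\<close> accounts for the two sums compared; the
        \<open>+ 1\<close> keeps the denominator positive if \<open>c 0 = 0\<close> and makes the
        final inequality strict.\<close>
      define \<epsilon> where "\<epsilon> = e / (2 * (c 0 + 1))"
      have \<epsilon>: "0 < \<epsilon>" using \<open>0 < e\<close> c0 by (simp add: \<epsilon>_def)
      obtain N where N: "\<And>z. z \<in> K \<Longrightarrow> \<exists>p. degree p \<le> N \<and>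
          (\<forall>t\<in>{0..1}. cmod (1 / (1 + of_real t * z) - poly p (of_real t)) \<le> \<epsilon>)"
        using uniform_poly_approx_kernel[OF K \<epsilon>] by blast
      have "dist (?S m z) (?S n z) < e" if "z \<in> K" "m \<ge> Suc N" "n \<ge> Suc N" for z m n
      proof -
        obtain p where p: "degree p \<le> N"
          "\<And>t. t \<in> {0..1} \<Longrightarrow> cmod (1 / (1 + of_real t * z) - poly p (of_real t)) \<le> \<epsilon>"
          using N[OF \<open>z \<in> K\<close>] by blast
        have "dist (?S k z) (moment c p) \<le> c 0 * \<epsilon>" if "Suc N \<le> k" for k
          unfolding dist_norm using p that by (intro quadrature_approx[OF quad]) auto
        from this[OF that(2)] this[OF that(3)]
        have "dist (?S m z) (?S n z) \<le> 2 * (c 0 * \<epsilon>)"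
          using dist_triangle3[of "?S m z" "?S n z" "moment c p"] by (simp add: dist_commute)
        also have "\<dots> < 2 * ((c 0 + 1) * \<epsilon>)" using \<epsilon> by simp
        also have "\<dots> = e" using c0 by (simp add: \<epsilon>_def field_simps)
        finally show ?thesis .
      qed
      then show "\<exists>M. \<forall>z\<in>K. \<forall>m\<ge>M. \<forall>n\<ge>M. dist (?S m z) (?S n z) < e" by blast
    qed
    then have "uniformly_convergent_on K ?S" by (rule Cauchy_uniformly_convergent)
    then show ?thesis unfolding uniformly_convergent_uniform_limit_iff G_def .
  qed
  have "G holomorphic_on cut_plane"
  proof (rule holomorphic_uniform_sequence)
    show "open cut_plane" using closed_cut by (simp add: open_Compl)
    then show "\<exists>d>0. cball z d \<subseteq> cut_plane \<and> uniform_limit (cball z d) ?S G sequentially"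
      if "z \<in> cut_plane" for z
      using that unif[OF compact_cball] open_contains_cball by metis
    have "x \<in> {0..1}" if "x \<in> X m" for x m using quad[of m] that by (auto simp: quadrature_def)
    then show "?S m holomorphic_on cut_plane" for m
      unfolding stieltjes_sum_def by (intro holomorphic_intros cut_plane_kernel_neq_0) auto
  qed
  moreover have "cmod (G z - (\<Sum>i<N. of_real (c i) * (- z) ^ i)) \<le> c 0 * (cmod z ^ N / (1 - cmod z))"
    if z: "cmod z < 1" for z N
  proof (rule tendsto_upperbound)
    have "z \<in> cut_plane" using z by auto
    then have "uniform_limit {z} ?S G sequentially" by (intro unif) auto
    then have "(\<lambda>m. ?S m z) \<longlonglongrightarrow> G z" by simp
    then show "(\<lambda>m. cmod (?S m z - (\<Sum>i<N. of_real (c i) * (- z) ^ i)))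
        \<longlonglongrightarrow> cmod (G z - (\<Sum>i<N. of_real (c i) * (- z) ^ i))"
      by (intro tendsto_intros)
    show "\<forall>\<^sub>F m in sequentially. cmod (?S m z - (\<Sum>i<N. of_real (c i) * (- z) ^ i))
        \<le> c 0 * (cmod z ^ N / (1 - cmod z))"
      using eventually_ge_at_top[of "Suc N"]
      by eventually_elim (rule quadrature_power_series[OF quad z], auto)
  qed simp
  ultimately show ?thesis using unif that by blast
qed

subsection \<open>Rational approximants\<close>

text \<open>Cancelling \<open>z ^ r\<close>, with \<open>r < N\<close> the order of a nonzero
  \<open>p\<close> at \<open>0\<close>, would leave a factor \<open>s\<close> that tends to
  \<open>0\<close> although \<open>poly s 0 \<noteq> 0\<close>.\<close>

lemma poly_bigo_power_imp_0:
  fixes p :: "complex poly"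
  assumes bigo: "poly p \<in> O[at 0](\<lambda>z. z ^ N)" and deg: "degree p < N"
  shows "p = 0"
proof (rule ccontr)
  assume "p \<noteq> 0"
  then obtain s where s: "p = [:- 0, 1:] ^ order 0 p * s" and "\<not> [:- 0, 1:] dvd s"
    using order_decomp by blast
  then have s0: "poly s 0 \<noteq> 0" by (simp add: poly_eq_0_iff_dvd)
  define r where "r = order 0 p"
  have "r < N" using order_degree[OF \<open>p \<noteq> 0\<close>, of 0] deg by (simp add: r_def)
  have "(\<lambda>z. z ^ r * poly s z) \<in> O[at 0](\<lambda>z. z ^ r * z ^ (N - r))"
  proof -
    have "poly p z = z ^ r * poly s z" for z
      by (subst s) (simp add: poly_power r_def)
    then have "poly p = (\<lambda>z. z ^ r * poly s z)" by blast
    then show ?thesis using bigo \<open>r < N\<close> by (simp flip: power_add)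
  qed
  moreover have nz: "\<forall>\<^sub>F z in at (0::complex). z ^ r \<noteq> 0"
    by (rule eventually_mono[OF eventually_neq_at_within[of 0]]) simp
  ultimately have "poly s \<in> O[at 0](\<lambda>z. z ^ (N - r))"
    by (subst (asm) landau_o.big.mult_cancel_left) auto
  moreover have "(\<lambda>z::complex. z ^ (N - r)) \<in> o[at 0](\<lambda>_. 1)"
    using \<open>r < N\<close> by (intro smalloI_tendsto tendsto_eq_intros refl) auto
  ultimately have "poly s \<in> o[at 0](\<lambda>_. 1)" by (rule landau_o.big_small_trans)
  then have "poly s \<midarrow>0\<rightarrow> 0" by (drule_tac smalloD_tendsto) simp
  moreover have "poly s \<midarrow>0\<rightarrow> poly s 0" by (intro tendsto_intros)
  ultimately show False using s0 LIM_unique by blast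
qed

text \<open>For two solutions, \<open>P * Q' - P' * Q\<close> has degree at most
  \<open>k + n\<close> but vanishes to order \<open>k + n + 1\<close> at \<open>0\<close>, so it is
  zero and the fractions coincide.\<close>

lemma pade_eqI:
  assumes Q: "Q \<noteq> 0" "degree P \<le> k" "degree Q \<le> n"
    and bigo: "(\<lambda>z. f z * poly Q z - poly P z) \<in> O[at 0](\<lambda>z. z ^ (k + n + 1))"
  shows "pade f k n = Fraction_Field.Fract P Q"
  unfolding pade_def
proof (rule the_equality)
  show "\<exists>P' Q'. Q' \<noteq> 0 \<and> degree P' \<le> k \<and> degree Q' \<le> n \<and>
      (\<lambda>z. f z * poly Q' z - poly P' z) \<in> O[at 0](\<lambda>z. z ^ (k + n + 1)) \<and>
      Fraction_Field.Fract P Q = Fraction_Field.Fract P' Q'"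
    using assms by blast
next
  fix r
  assume "\<exists>P' Q'. Q' \<noteq> 0 \<and> degree P' \<le> k \<and> degree Q' \<le> n \<and>
      (\<lambda>z. f z * poly Q' z - poly P' z) \<in> O[at 0](\<lambda>z. z ^ (k + n + 1)) \<and>
      r = Fraction_Field.Fract P' Q'"
  then obtain P' Q' where Q': "Q' \<noteq> 0" "degree P' \<le> k" "degree Q' \<le> n"
    and bigo': "(\<lambda>z. f z * poly Q' z - poly P' z) \<in> O[at 0](\<lambda>z. z ^ (k + n + 1))"
    and r: "r = Fraction_Field.Fract P' Q'" by blast
  have bounded: "poly q \<in> O[at 0](\<lambda>_. 1)" for q :: "complex poly"
    by (rule bigoI_tendsto[of _ _ "poly q 0"]) (auto intro!: tendsto_eq_intros)
  have "(\<lambda>z. (f z * poly Q' z - poly P' z) * poly Q z - (f z * poly Q z - poly P z) * poly Q' z)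
      \<in> O[at 0](\<lambda>z. z ^ (k + n + 1) * 1)"
    by (intro sum_in_bigo landau_o.big.mult bigo bigo' bounded)
  also have "(\<lambda>z. (f z * poly Q' z - poly P' z) * poly Q z - (f z * poly Q z - poly P z) * poly Q' z)
      = poly (P * Q' - P' * Q)"
    by (simp add: fun_eq_iff algebra_simps)
  finally have "poly (P * Q' - P' * Q) \<in> O[at 0](\<lambda>z. z ^ (k + n + 1))"
    by (simp only: mult_1_right)
  moreover have "degree (P * Q' - P' * Q) < k + n + 1"
    using degree_diff_le[of "P * Q'" "k + n" "P' * Q"] degree_mult_le[of P Q'] degree_mult_le[of P' Q]
      Q Q' by simp
  ultimately have "P * Q' - P' * Q = 0" by (rule poly_bigo_power_imp_0)
  then show "r = Fraction_Field.Fract P Q"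
    using Q Q' by (simp add: r eq_fract)
qed

text \<open>\<open>P\<close> and \<open>Q\<close> may have common factors; the reduced denominator
  divides \<open>Q\<close>, so it vanishes only where \<open>Q\<close> does.\<close>

lemma ratfun_Fract:
  assumes "poly Q z \<noteq> 0"
  shows "\<not> ratfun_pole (Fraction_Field.Fract P Q) z"
    and "ratfun_eval (Fraction_Field.Fract P Q) z = poly P z / poly Q z"
proof -
  define a b where "a = fst (quot_of_fract (Fraction_Field.Fract P Q))"
    and "b = snd (quot_of_fract (Fraction_Field.Fract P Q))"
  have "Q \<noteq> 0" using assms by auto
  have b: "b \<noteq> 0" and cop: "coprime a b"
    by (simp_all add: a_def b_def snd_quot_of_fract_nonzero coprime_quot_of_fract)
  have "Fraction_Field.Fract a b = Fraction_Field.Fract P Q"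
    unfolding a_def b_def by (metis Fract_quot_of_fract)
  then have eq: "a * Q = P * b" using b \<open>Q \<noteq> 0\<close> by (simp add: eq_fract)
  then have "b dvd a * Q" by simp
  then have "b dvd Q" using cop by (simp add: coprime_commute coprime_dvd_mult_right_iff)
  then have b_z: "poly b z \<noteq> 0" using assms by auto
  then show "\<not> ratfun_pole (Fraction_Field.Fract P Q) z"
    by (simp add: ratfun_pole_def b_def)
  have "poly a z * poly Q z = poly P z * poly b z"
    using arg_cong[OF eq, of "\<lambda>p. poly p z"] by simp
  then show "ratfun_eval (Fraction_Field.Fract P Q) z = poly P z / poly Q z"
    using b_z assms by (simp add: ratfun_eval_def a_def b_def frac_eq_eq)
qed

lemma stieltjes_sum_eq_ratio:
  assumes "finite X" and "\<And>x. x \<in> X \<Longrightarrow> 1 + of_real x * z \<noteq> 0"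
  shows "poly (\<Prod>x\<in>X. [:1, of_real x:]) z \<noteq> 0"
    and "poly (\<Sum>x\<in>X. smult (of_real (w x)) (\<Prod>y\<in>X - {x}. [:1, of_real y:])) z
      = stieltjes_sum X w z * poly (\<Prod>x\<in>X. [:1, of_real x:]) z"
proof -
  show "poly (\<Prod>x\<in>X. [:1, of_real x:]) z \<noteq> 0"
    using assms by (simp add: poly_prod mult.commute)
  show "poly (\<Sum>x\<in>X. smult (of_real (w x)) (\<Prod>y\<in>X - {x}. [:1, of_real y:])) z
      = stieltjes_sum X w z * poly (\<Prod>x\<in>X. [:1, of_real x:]) z"
    unfolding stieltjes_sum_def sum_distrib_right poly_sum
  proof (intro sum.cong refl)
    fix x assume x: "x \<in> X"
    have "poly (\<Prod>x\<in>X. [:1, of_real x:]) z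
        = (1 + of_real x * z) * poly (\<Prod>y\<in>X - {x}. [:1, of_real y:]) z"
      by (subst prod.remove[OF assms(1) x]) (simp add: algebra_simps)
    then show "poly (smult (of_real (w x)) (\<Prod>y\<in>X - {x}. [:1, of_real y:])) z
        = of_real (w x) / (1 + of_real x * z) * poly (\<Prod>x\<in>X. [:1, of_real x:]) z"
      using assms(2)[OF x] by simp
  qed
qed

text \<open>\<open>T\<close> collects the first \<open>d\<close> Taylor terms of \<open>f\<close>
  and \<open>(- z) ^ d * G z\<close> is the rest. Replacing \<open>G\<close> by the quadrature sum
  in this splitting gives the approximant with numerator degree \<open>m + d - 1\<close>.\<close>

lemma pade_stieltjes:
  fixes f G :: "complex \<Rightarrow> complex"
  assumes quad: "quadrature c m X w" and m: "0 < m"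
    and f: "\<And>z. cmod z < 1 \<Longrightarrow> f z = poly T z + (- z) ^ d * G z"
    and T: "T = 0 \<or> degree T < d"
    and G: "\<And>z. cmod z < 1 \<Longrightarrow>
      cmod (G z - (\<Sum>i<2 * m. of_real (c i) * (- z) ^ i)) \<le> c 0 * (cmod z ^ (2 * m) / (1 - cmod z))"
    and z: "z \<in> cut_plane"
  shows "\<not> ratfun_pole (pade f (m + d - 1) m) z"
    and "ratfun_eval (pade f (m + d - 1) m) z = poly T z + (- z) ^ d * stieltjes_sum X w z"
proof -
  have X: "finite X" "card X \<le> m" "X \<subseteq> {0..1}" using quad by (auto simp: quadrature_def)
  have neq: "1 + of_real x * z \<noteq> 0" if "z \<in> cut_plane" "x \<in> X" for x z
    using that X by (intro cut_plane_kernel_neq_0) auto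
  define Q :: "complex poly" where "Q = (\<Prod>x\<in>X. [:1, of_real x:])"
  define R :: "complex poly" where
    "R = (\<Sum>x\<in>X. smult (of_real (w x)) (\<Prod>y\<in>X - {x}. [:1, of_real y:]))"
  \<comment> \<open>Both summands respect the degree bound: \<open>T\<close> has degree at most
    \<open>d - 1\<close> or is zero, with \<open>degree Q \<le> m\<close>, and \<open>R\<close> has
    degree at most \<open>m - 1\<close>.\<close>
  define P where "P = T * Q + [:0, -1:] ^ d * R"
  have poly_Q: "poly Q z \<noteq> 0" and poly_R: "poly R z = stieltjes_sum X w z * poly Q z"
    if "z \<in> cut_plane" for z
    using stieltjes_sum_eq_ratio[OF X(1) neq[OF that]] by (auto simp: Q_def R_def)
  have poly_P: "poly P z = (poly T z + (- z) ^ d * stieltjes_sum X w z) * poly Q z"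
    if "z \<in> cut_plane" for z
    using poly_R[OF that] by (simp add: P_def poly_power algebra_simps)
  have Q_neq_0: "Q \<noteq> 0" using poly_Q[OF z] by auto
  have deg_prod: "degree (\<Prod>x\<in>Y. [:1, complex_of_real x:]) \<le> card Y" if "finite Y" for Y :: "real set"
  proof -
    have "degree (\<Prod>x\<in>Y. [:1, complex_of_real x:]) \<le> (\<Sum>x\<in>Y. degree [:1, complex_of_real x:])"
      using degree_prod_sum_le[OF that, of "\<lambda>x. [:1, complex_of_real x:]"] by (simp only: o_def)
    also have "\<dots> \<le> (\<Sum>x\<in>Y. 1)" by (intro sum_mono) simp
    finally show ?thesis by simp
  qed
  have deg_Q: "degree Q \<le> m" using deg_prod[OF X(1)] X(2) by (simp add: Q_def)
  have deg_R: "degree R \<le> m - 1"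
    unfolding R_def
  proof (intro degree_sum_le X(1) order.trans[OF degree_smult_le])
    fix x assume "x \<in> X"
    then show "degree (\<Prod>y\<in>X - {x}. [:1, complex_of_real y:]) \<le> m - 1"
      using deg_prod[of "X - {x}"] X by simp
  qed
  have deg_P: "degree P \<le> m + d - 1"
    unfolding P_def
  proof (rule degree_add_le)
    show "degree (T * Q) \<le> m + d - 1"
      using T degree_mult_le[of T Q] deg_Q m by auto
    show "degree ([:0, -1:] ^ d * R) \<le> m + d - 1"
      using degree_mult_le[of "[:0, -1:] ^ d" R] degree_power_le[of "[:0, -1:: complex:]" d] deg_R m by simp
  qed
  \<comment> \<open>The prefactor contributes order \<open>d\<close> and the quadrature order
    \<open>2 * m\<close>; together they make \<open>(m + d - 1) + m + 1\<close>, the order that the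
    approximant needs.\<close>
  have "(\<lambda>z. f z * poly Q z - poly P z) \<in> O[at 0](\<lambda>z. z ^ d * z ^ (2 * m) * 1)"
  proof -
    have small: "\<forall>\<^sub>F z in at 0. cmod z < 1 / 2"
      by (rule eventually_at_ball'[of "1 / 2" 0 UNIV, simplified, THEN eventually_mono]) (auto simp: dist_norm)
    have "(\<lambda>z. G z - stieltjes_sum X w z) \<in> O[at 0](\<lambda>z. z ^ (2 * m))"
    \<comment> \<open>\<open>G\<close> and the quadrature sum each differ from the same partial sum
      by at most \<open>c 0 * |z| ^ (2 m) / (1 - |z|)\<close>, and
      \<open>1 - |z| > 1 / 2\<close>.\<close>
    proof (rule bigoI[of _ "4 * c 0"], use small in eventually_elim)
      fix z :: complex assume z: "cmod z < 1 / 2"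
      have c0: "0 \<le> c 0" using quad m by (auto simp: quadrature_def intro!: sum_nonneg)
      let ?s = "\<Sum>i<2 * m. of_real (c i) * (- z) ^ i"
      have "cmod (G z - stieltjes_sum X w z) = cmod ((G z - ?s) - (stieltjes_sum X w z - ?s))"
        by simp
      also have "\<dots> \<le> 2 * (c 0 * (cmod z ^ (2 * m) / (1 - cmod z)))"
        using norm_triangle_ineq4[of "G z - ?s" "stieltjes_sum X w z - ?s"] G[of z]
          quadrature_power_series[OF quad, of z "2 * m"] z m by simp
      also have "\<dots> \<le> 2 * (c 0 * (cmod z ^ (2 * m) / (1 / 2)))"
        using z c0 by (intro mult_left_mono divide_left_mono) auto
      finally show "cmod (G z - stieltjes_sum X w z) \<le> 4 * c 0 * cmod (z ^ (2 * m))"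
        by (simp add: norm_power)
    qed
    moreover have "(\<lambda>z. (- z) ^ d) \<in> O[at 0](\<lambda>z::complex. z ^ d)"
      by (rule bigoI[of _ 1]) (simp add: norm_power)
    moreover have "poly Q \<in> O[at 0](\<lambda>_. 1)"
      by (rule bigoI_tendsto[of _ _ "poly Q 0"]) (auto intro!: tendsto_eq_intros)
    ultimately have "(\<lambda>z. (- z) ^ d * (G z - stieltjes_sum X w z) * poly Q z)
        \<in> O[at 0](\<lambda>z. z ^ d * z ^ (2 * m) * 1)"
      by (intro landau_o.big.mult)
    moreover have "\<forall>\<^sub>F z in at 0. f z * poly Q z - poly P z
        = (- z) ^ d * (G z - stieltjes_sum X w z) * poly Q z"
      using small
    proof eventually_elim
      fix z :: complex assume z: "cmod z < 1 / 2"
      then have "z \<in> cut_plane" by auto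
      then show "f z * poly Q z - poly P z = (- z) ^ d * (G z - stieltjes_sum X w z) * poly Q z"
        using f[of z] poly_P[of z] z by (simp add: algebra_simps)
    qed
    ultimately show ?thesis by (subst landau_o.big.in_cong)
  qed
  also have "(\<lambda>z::complex. z ^ d * z ^ (2 * m) * 1) = (\<lambda>z. z ^ ((m + d - 1) + m + 1))"
    using m by (simp flip: power_add) (simp add: mult_2 add_ac)
  finally have pade: "pade f (m + d - 1) m = Fraction_Field.Fract P Q"
    by (intro pade_eqI Q_neq_0 deg_P deg_Q)
  show "\<not> ratfun_pole (pade f (m + d - 1) m) z"
    unfolding pade by (rule ratfun_Fract[OF poly_Q[OF z]])
  show "ratfun_eval (pade f (m + d - 1) m) z = poly T z + (- z) ^ d * stieltjes_sum X w z"
    unfolding pade by (subst ratfun_Fract[OF poly_Q[OF z]]) (use poly_P[OF z] poly_Q[OF z] in simp)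
qed

section \<open>Analytic continuation on the cut plane\<close>

lemma connected_ray_complement: "connected (- complex_of_real ` {1..})"
proof (intro starlike_imp_connected)
  show "starlike (- complex_of_real ` {1..})"
    unfolding starlike_def
  proof (intro bexI[of _ 0] ballI subsetI)
    fix z y assume z: "z \<in> - complex_of_real ` {1..}" and "y \<in> closed_segment 0 z"
    then obtain u where u: "0 \<le> u" "u \<le> 1" "y = of_real u * z"
      by (auto simp: closed_segment_def scaleR_conv_of_real)
    show "y \<in> - complex_of_real ` {1..}"
    proof
      assume "y \<in> complex_of_real ` {1..}"
      then obtain x where x: "1 \<le> x" "of_real u * z = of_real x" using u by auto
      then have "u \<noteq> 0" by auto
      then have "z = of_real (x / u)" using x by (simp add: field_simps)
      moreover have "1 \<le> x / u" using x u \<open>u \<noteq> 0\<close> by (simp add: field_simps)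
      ultimately show False using z by blast
    qed
  qed auto
qed

lemma open_ray_complement: "open (- complex_of_real ` {1..})"
proof -
  have "complex_of_real ` {1..} = {z. Im z = 0 \<and> 1 \<le> Re z}"
    by (auto simp: complex_eq_iff image_iff)
  moreover have "closed \<dots>"
    by (intro closed_Collect_conj closed_Collect_eq closed_Collect_le continuous_intros)
  ultimately show ?thesis by (simp add: open_Compl)
qed

text \<open>The existence of \<open>F\<close> guarantees that the chosen function has the defining
  properties; the identity theorem from the unit disc then equates the two.\<close>

lemma hypergeo_fun_eqI:
  assumes hol: "F holomorphic_on (- complex_of_real ` {1..})"
    and F: "\<And>z. cmod z < 1 \<Longrightarrow>
      F z = eval_fps (fps_hypergeo (map complex_of_real (\<sigma> # A)) (map complex_of_real B) 1) z"
    and z: "z \<in> - complex_of_real ` {1..}"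
  shows "hypergeo_fun \<sigma> A B z = F z"
proof -
  have hol': "hypergeo_fun \<sigma> A B holomorphic_on (- complex_of_real ` {1..})"
    and eq: "\<And>z. cmod z < 1 \<Longrightarrow> hypergeo_fun \<sigma> A B z
      = eval_fps (fps_hypergeo (map complex_of_real (\<sigma> # A)) (map complex_of_real B) 1) z"
    using someI[where P = "\<lambda>F. F holomorphic_on (- complex_of_real ` {1..}) \<and> (\<forall>z. norm z < 1 \<longrightarrow>
      F z = eval_fps (fps_hypergeo (map complex_of_real (\<sigma> # A)) (map complex_of_real B) 1) z)", of F]
      hol F unfolding hypergeo_fun_def by blast+
  show ?thesis
  proof (rule analytic_continuation_open[of "ball 0 1" "- complex_of_real ` {1..}" "hypergeo_fun \<sigma> A B" F])
    show "ball 0 1 \<subseteq> - complex_of_real ` {1..}" by auto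
  qed (use hol hol' z eq F open_ray_complement connected_ray_complement in auto)
qed

text \<open>The factor \<open>pochhammer \<sigma> n / fact n\<close> is written as a product over
  one index so that it is an instance of the Pochhammer quotients above, the majorization being
  \<open>\<sigma> \<le> 1\<close>.\<close>

definition hypergeo_moment :: "real \<Rightarrow> real list \<Rightarrow> real list \<Rightarrow> nat \<Rightarrow> real" where
  "hypergeo_moment \<sigma> A B n =
     (\<Prod>i<1::nat. pochhammer \<sigma> n / pochhammer 1 n) * (\<Prod>i<length A. pochhammer (A ! i) n / pochhammer (B ! i) n)"

lemma foldl_pochhammer:
  "foldl (\<lambda>r a. r * pochhammer a n) v (map complex_of_real as)
    = v * of_real (\<Prod>i<length as. pochhammer (as ! i) n)"
proof -
  have "foldl (\<lambda>r a. r * pochhammer a n) v (map complex_of_real as)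
      = v * of_real (prod_list (map (\<lambda>a. pochhammer a n) as))"
    by (induction as arbitrary: v) (simp_all add: pochhammer_of_real)
  also have "prod_list (map (\<lambda>a. pochhammer a n) as) = (\<Prod>i<length as. pochhammer (as ! i) n)"
    by (simp add: prod.list_conv_set_nth atLeast0LessThan)
  finally show ?thesis .
qed

lemma fps_hypergeo_nth_moment:
  assumes "length A = length B"
  shows "fps_nth (fps_hypergeo (map complex_of_real (\<sigma> # A)) (map complex_of_real B) 1) n
    = of_real (hypergeo_moment \<sigma> A B n)"
proof -
  have "fps_nth (fps_hypergeo (map complex_of_real (\<sigma> # A)) (map complex_of_real B) 1) n
    = of_real (pochhammer \<sigma> n * (\<Prod>i<length A. pochhammer (A ! i) n)) /
      of_real ((\<Prod>i<length B. pochhammer (B ! i) n) * fact n)"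
    by (simp add: foldl_pochhammer pochhammer_of_real)
  also have "\<dots> = of_real (hypergeo_moment \<sigma> A B n)"
    using assms by (simp add: hypergeo_moment_def prod_dividef pochhammer_fact)
  finally show ?thesis .
qed

lemma hausdorff_hypergeo_moment:
  assumes maj: "B \<prec>\<^sup>W A" and \<sigma>: "0 < \<sigma>" "\<sigma> \<le> 1"
  shows "hausdorff (hypergeo_moment \<sigma> A B)"
  unfolding hypergeo_moment_def
proof (intro hausdorff_mult hausdorff_pochhammer_quotient)
  show "(\<Sum>i<k. \<sigma>) \<le> (\<Sum>i<k. 1)" for k :: nat using \<sigma> by (simp add: mult_left_le)
next
  fix k assume k: "k \<le> length A"
  have "sum_list (take k L) = (\<Sum>i<k. L ! i)" if "length L = length A" for L :: "real list"
    using k that by (simp add: sum_list_sum_nth atLeast0LessThan min_def)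
  moreover have "length A = length B" using maj by (simp add: weakly_supermajorized_def)
  moreover have "sum_list (take k A) \<le> sum_list (take k B)"
    using maj k by (cases "k = 0") (auto simp: weakly_supermajorized_def)
  ultimately show "(\<Sum>i<k. A ! i) \<le> (\<Sum>i<k. B ! i)" by simp
next
  show "B ! i \<le> B ! Suc i" if "Suc i < length A" for i
    using maj that by (auto simp: weakly_supermajorized_def sorted_iff_nth_mono)
qed (use maj \<sigma> in \<open>auto simp: weakly_supermajorized_def\<close>)

lemma exists_quadratures:
  assumes "hausdorff c"
  obtains X w where "\<And>m. quadrature c m (X m) (w m)"
proof -
  have "\<exists>X w. quadrature c m X w" for m
  proof (cases "m = 0")
    case True
    then show ?thesis by (intro exI[of _ "{}"] exI[of _ "\<lambda>_. 0"]) (simp add: quadrature_def)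
  next
    case False
    then show ?thesis using gauss_quadrature[OF assms, of m] unfolding quadrature_def by (metis neq0_conv)
  qed
  then show ?thesis using that by metis
qed

theorem theorem10:
  fixes q :: nat and A B :: "real list" and \<sigma> :: real and j :: int
  assumes "q \<ge> 1" and "length A = q" and "length B = q"
    and "B \<prec>\<^sup>W A"
    and "0 < \<sigma>" and "\<sigma> \<le> 1"
    and "j \<ge> -1"
  shows "ratfun_converges_compactly
           (\<lambda>m. pade (\<lambda>z. hypergeo_fun \<sigma> A B (- z)) (nat (int m + j)) m)
           (\<lambda>z. hypergeo_fun \<sigma> A B (- z))
           (- complex_of_real ` {..-1})"
proof -
  \<comment> \<open>The number of Taylor terms split off; \<open>j = -1\<close> gives none. The
    shift by \<open>d\<close> in \<open>c\<close> corresponds to the weight \<open>t ^ d\<close> in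
    the functional.\<close>
  define d where "d = nat (j + 1)"
  define a where "a = hypergeo_moment \<sigma> A B"
  define c where "c n = a (n + d)" for n
  have "hausdorff c"
    unfolding c_def a_def using assms by (intro hausdorff_shift hausdorff_hypergeo_moment)
  then obtain X w where quad: "\<And>m. quadrature c m (X m) (w m)" using exists_quadratures by blast
  obtain G where G_hol: "G holomorphic_on cut_plane"
    and unif: "\<And>K. compact K \<Longrightarrow> K \<subseteq> cut_plane \<Longrightarrow>
      uniform_limit K (\<lambda>m. stieltjes_sum (X m) (w m)) G sequentially"
    and G_series: "\<And>z N. cmod z < 1 \<Longrightarrow>
      cmod (G z - (\<Sum>i<N. of_real (c i) * (- z) ^ i)) \<le> c 0 * (cmod z ^ N / (1 - cmod z))"
    using stieltjes_limit[of c X w] quad by blast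
  define T where "T = (\<Sum>i<d. monom (of_real (a i) * (- 1) ^ i) i :: complex poly)"
  have poly_T: "poly T z = (\<Sum>i<d. of_real (a i) * (- z) ^ i)" for z
    by (simp add: T_def poly_sum poly_monom mult.assoc flip: power_mult_distrib)
  have deg_T: "T = 0 \<or> degree T < d"
  proof (cases "d = 0")
    case False
    then have "degree T < d" unfolding T_def
      by (intro degree_sum_less) (auto intro: order.strict_trans1[OF degree_monom_le])
    then show ?thesis ..
  qed (simp add: T_def)
  let ?f = "\<lambda>z. hypergeo_fun \<sigma> A B (- z)"
  have uminus_cut: "- z \<in> - complex_of_real ` {1..} \<longleftrightarrow> z \<in> cut_plane" for z
    by (auto simp: image_iff complex_eq_iff)
  have f_eq: "?f z = poly T z + (- z) ^ d * G z" if z: "z \<in> cut_plane" for z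
  proof -
    \<comment> \<open>The continuation in the variable \<open>u = - z\<close>. On the disc, its
      first \<open>d\<close> Taylor terms come from \<open>T\<close>, and the series of
      \<open>G\<close>, multiplied by \<open>u ^ d\<close>, supplies the others.\<close>
    define F where "F u = poly T (- u) + u ^ d * G (- u)" for u
    have "hypergeo_fun \<sigma> A B (- z) = F (- z)"
    proof (rule hypergeo_fun_eqI)
      have "(G \<circ> uminus) holomorphic_on (- complex_of_real ` {1..})"
      proof (rule holomorphic_on_compose_gen[OF _ G_hol])
        show "uminus ` (- complex_of_real ` {1..}) \<subseteq> cut_plane"
          using uminus_cut by (metis image_subsetI minus_minus)
      qed (intro holomorphic_intros)
      then show "F holomorphic_on (- complex_of_real ` {1..})"
        unfolding F_def by (auto intro!: holomorphic_intros simp: o_def)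
    next
      fix u :: complex assume u: "cmod u < 1"
      \<comment> \<open>For fixed \<open>u\<close>, the bound of \<open>G\<close> against its
        partial sums tends to \<open>0\<close> with \<open>N\<close>, so the power series converges
        to \<open>G (- u)\<close>.\<close>
      have "(\<lambda>N. (\<Sum>i<N. of_real (c i) * u ^ i) - G (- u)) \<longlonglongrightarrow> 0"
      proof (rule Lim_null_comparison)
        show "\<forall>\<^sub>F N in sequentially. cmod ((\<Sum>i<N. of_real (c i) * u ^ i) - G (- u))
            \<le> c 0 * (cmod u ^ N / (1 - cmod u))"
          using G_series[of "- u"] u by (simp add: norm_minus_commute)
        show "(\<lambda>N. c 0 * (cmod u ^ N / (1 - cmod u))) \<longlonglongrightarrow> 0"
          using u by (intro tendsto_mult_right_zero tendsto_divide_zero LIMSEQ_power_zero) simp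
      qed
      then have "(\<lambda>i. of_real (c i) * u ^ i) sums G (- u)"
        by (simp add: sums_def LIM_zero_iff)
      then have "(\<lambda>i. u ^ d * (of_real (c i) * u ^ i)) sums (u ^ d * G (- u))"
        by (rule sums_mult)
      then have "(\<lambda>i. of_real (a (i + d)) * u ^ (i + d)) sums (u ^ d * G (- u))"
        by (simp add: c_def power_add mult_ac)
      then have "(\<lambda>i. of_real (a i) * u ^ i) sums (F u)"
        by (subst (asm) sums_iff_shift) (simp add: F_def poly_T add.commute)
      then show "F u = eval_fps (fps_hypergeo (map complex_of_real (\<sigma> # A)) (map complex_of_real B) 1) u"
        using assms fps_hypergeo_nth_moment[of A B \<sigma>]
        by (simp add: eval_fps_def a_def sums_iff del: fps_hypergeo_nth list.map)
    qed (use z uminus_cut in auto)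
    then show ?thesis by (simp add: F_def)
  qed
  show ?thesis
    unfolding ratfun_converges_compactly_def
  proof (intro allI impI conjI)
    fix K assume "compact K \<and> K \<subseteq> cut_plane"
    then have K: "compact K" "K \<subseteq> cut_plane" by auto
    have index: "nat (int m + j) = m + d - 1" if "0 < m" for m
      using assms(7) that by (simp add: d_def nat_diff_distrib' nat_add_distrib)
    have no_pole: "\<not> ratfun_pole (pade ?f (nat (int m + j)) m) z"
      and eval: "ratfun_eval (pade ?f (nat (int m + j)) m) z
        = poly T z + (- z) ^ d * stieltjes_sum (X m) (w m) z"
      if "0 < m" "z \<in> cut_plane" for m z
    proof -
      have f: "?f z = poly T z + (- z) ^ d * G z" if "cmod z < 1" for z
        using that by (intro f_eq) auto
      show "\<not> ratfun_pole (pade ?f (nat (int m + j)) m) z"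
        unfolding index[OF that(1)] using pade_stieltjes(1)[OF quad that(1) f deg_T G_series that(2)] .
      show "ratfun_eval (pade ?f (nat (int m + j)) m) z
          = poly T z + (- z) ^ d * stieltjes_sum (X m) (w m) z"
        unfolding index[OF that(1)] using pade_stieltjes(2)[OF quad that(1) f deg_T G_series that(2)] .
    qed
    show "\<forall>\<^sub>F m in sequentially. \<forall>z\<in>K. \<not> ratfun_pole (pade ?f (nat (int m + j)) m) z"
      using eventually_gt_at_top[of 0] by eventually_elim (use no_pole K in auto)
    have "uniform_limit K (\<lambda>m z. poly T z + (- z) ^ d * stieltjes_sum (X m) (w m) z)
        (\<lambda>z. poly T z + (- z) ^ d * G z) sequentially"
    proof (intro uniform_limit_add uniform_lim_mult uniform_limit_const unif K)
      \<comment> \<open>Uniform limits can be multiplied because both limit functions are bounded on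
        the compact set \<open>K\<close>.\<close>
      show "bounded ((\<lambda>z. (- z) ^ d) ` K)"
        using K by (intro compact_imp_bounded compact_continuous_image continuous_intros)
      show "bounded (G ` K)"
        using K G_hol by (intro compact_imp_bounded compact_continuous_image)
          (auto intro: holomorphic_on_imp_continuous_on holomorphic_on_subset)
    qed
    also have "?this \<longleftrightarrow> uniform_limit K (\<lambda>m. ratfun_eval (pade ?f (nat (int m + j)) m)) ?f sequentially"
    proof (rule uniform_limit_cong)
      show "\<forall>\<^sub>F m in sequentially. \<forall>z\<in>K. poly T z + (- z) ^ d * stieltjes_sum (X m) (w m) z
          = ratfun_eval (pade ?f (nat (int m + j)) m) z"
        using eventually_gt_at_top[of 0] by eventually_elim (use eval K in auto)
      show "poly T z + (- z) ^ d * G z = ?f z" if "z \<in> K" for z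
        using that K f_eq by auto
    qed
    finally show "uniform_limit K (\<lambda>m. ratfun_eval (pade ?f (nat (int m + j)) m)) ?f sequentially" .
  qed
qed

end
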